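(* Let $(A,H,D)$ be the spectral triple on the three-point space $Y=\{1,2,3\}$ given in the context, and let $(\Omega,d,* )$ be the differential $*$-calculus of Connes forms of $(A,H,D)$, with free right $A$-module basis $e_1=[D,\chi_1]$, $e_2=[D,\chi_2]$ of $\Omega^1$. Let $J$ be any one of the $8$ complex structures on $(\Omega,d,* )$ whose restriction to $\Omega^1$ is given by $Je_i=e_1J_{1i}+e_2J_{2i}$ ($i=1,2$) with $(J_{ki})_{k,i=1,2}$ one of the matrices (where $i=\sqrt{-1}$ in front of the matrices) $$\pm i\begin{bmatrix}1-2\chi_3&0\\2\chi_1&2\chi_2-1\end{bmatrix},\qquad \pm i\begin{bmatrix}1-2\chi_3&-2\chi_2\\2\chi_1&2\chi_3-1\end{bmatrix},$$ $$\pm i\begin{bmatrix}2\chi_1-1&2\chi_2\\0&1-2\chi_3\end{bmatrix},\qquad \pm i\begin{bmatrix}2\chi_1-1&0\\0&1-2\chi_2\end{bmatrix}.$$ Then there is no Kähler metric compatible with $J$; that is, there is no metric $g:\Omega^1\otimes_A\Omega^1\to A$ compatible with $J$ whose fundamental form $\omega$ satisfies $d\omega=0$.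
   Context: **The spectral triple.** Let $Y=\{1,2,3\}$ and let $A=\mathcal{C}(Y)\cong\mathbb{C}^3$ be the $*$-algebra of complex functions on $Y$ (pointwise operations, complex conjugation). The functions $\chi_i$ are defined by $\chi_i(j)=\delta_{ij}$, $i,j\in\{1,2,3\}$. Let $H=\mathbb{C}^2_{12}\oplus\mathbb{C}^2_{23}\oplus\mathbb{C}^2_{13}$ (three copies of $\mathbb{C}^2$). Define $\pi:A\to B(H)$ by $$\pi(f)=\begin{bmatrix} f(1)&0\\0&f(2)\end{bmatrix}_{12}\oplus\begin{bmatrix} f(2)&0\\0&f(3)\end{bmatrix}_{23}\oplus\begin{bmatrix} f(1)&0\\0&f(3)\end{bmatrix}_{13},$$ $$D=\begin{bmatrix}0&1\\1&0\end{bmatrix}_{12}\oplus\begin{bmatrix}0&1\\1&0\end{bmatrix}_{23}\oplus\begin{bmatrix}0&1\\1&0\end{bmatrix}_{13}.$$ Elements $a\in A$ are identified with $\pi(a)$, and $[D,a]=D\pi(a)-\pi(a)D$. **Connes forms.** Let $\Omega_u^1A$ be the kernel of the multiplication $A\otimes A\to A$ and $\Omega_uA=T_A(\Omega_u^1A)$ the universal differential graded algebra (tensor algebra over $A$), with the unique degree one (graded) differential $d$ such that $d(a)=1\otimes a-a\otimes 1$ for $a\in A$. Let $\pi_u:\Omega_uA\to B(H)$, $\pi_u(a_0da_1\cdots da_p)=a_0[D,a_1]\cdots[D,a_p]$. Let $\mathcal{J}_0=\bigoplus_p\mathcal{J}_0^p$ with $\mathcal{J}_0^p=\{\omega\in\Omega_u^pA\mid\pi_u(\omega)=0\}$,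 and let $\mathcal{J}=\mathcal{J}_0+d\mathcal{J}_0$, which is a graded differential ideal. The differential graded algebra of Connes forms is $\Omega=\Omega_uA/\mathcal{J}=\bigoplus_n\Omega^n$, with product written $\wedge$ and $\Omega^0=A$. Its degree-one part $\Omega^1$ is identified via $\pi_u$ with the $A$-bimodule of operators $\sum_j a_0^j[D,a_1^j]$, with $da=[D,a]$. It is a differential $*$-calculus: the involution of $A$ extends to a grading-preserving (conjugate-linear) involution $\xi\mapsto\xi^*$ on $\Omega$ with $d(\xi)^*=d(\xi^* )$ and $(\xi\wedge\eta)^*=(-1)^{|\xi||\eta|}\eta^*\wedge\xi^*$ for homogeneous $\xi,\eta$. In particular $[D,a]^*=[D,a^*]$ as elements of $\Omega^1$ (this is not the operator adjoint). The elements $e_1,e_2$ form both a free right and a free left basis of $\Omega^1$. **Almost complex and complex structures.** An almost complex structure on a differential $*$-calculus $(\Omega,d,* )$ over $A$ is a degree zero derivation $J:\Omega\to\Omega$ such that (i) $J$ is identically $0$ on $A$ (hence is an $A$-bimodule endomorphism of $\Omega$); (ii) $J^2=-1$ on $\Omega^1$; (iii) $J(\xi^* )=J(\xi)^*$ for $\xi\in\Omega^1$. For $p,q\ge 0$ put $\Omega^{p,q}=\{\xi\in\Omega^{p+q}\mid J\xi=(p-q)\sqrt{-1}\,\xi\}$; then $\Omega^n=\bigoplus_{p+q=n}\Omega^{p,q}$, and $\pi^{p,q}:\Omega^{p+q}\to\Omega^{p,q}$ denotes the associated projection. $J$ is integrable if $d\Omega^{1,0}\subset\Omega^{2,0}\oplus\Omega^{1,1}$,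 and a complex structure is an integrable almost complex structure. Each matrix listed in the claim determines a complex structure on $\Omega$ (by right $A$-linear extension to $\Omega^1$ and then by the derivation property). **Metrics.** A metric is a non-degenerate $A$-bimodule morphism $g:\Omega^1\otimes_A\Omega^1\to A$, where non-degenerate means that $\xi\mapsto g(\xi,\cdot)$ is a right $A$-module isomorphism $\Omega^1\to(\Omega^1)'$, with $(\Omega^1)'$ the right $A$-dual of $\Omega^1$. The metric $g$ is compatible with $J$ if $g\circ(J\otimes J)=g$. The inverse of $g$ is the element $\mathfrak{g}=\mathfrak{g}(1)\in\Omega^1\otimes_A\Omega^1$ given by the bimodule morphism $\mathfrak{g}:A\to\Omega^1\otimes_A\Omega^1$ obtained from $g$ via a dual basis of $\Omega^1$; it is characterized by $(g\otimes\mathrm{id})(\xi\otimes\mathfrak{g})=\xi=(\mathrm{id}\otimes g)(\mathfrak{g}\otimes\xi)$ for all $\xi\in\Omega^1$. **Kähler metrics.** For a complex structure $J$ and a compatible metric $g$ with inverse $\mathfrak{g}$, the fundamental form is $$\omega=\wedge\,(J\otimes\mathrm{id})(\pi^{1,0}\otimes\pi^{0,1})(\mathfrak{g})\in\Omega^{1,1},$$ where $\wedge:\Omega^1\otimes_A\Omega^1\to\Omega^2$ is the product. The metric $g$ is Kähler if $d\omega=0$. *)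

theory Defs
  imports "HOL-Analysis.Analysis"
begin

section \<open>The spectral triple\<close>

text \<open>The point set is the three-element type \<^typ>\<open>3\<close>, whose elements are \<open>1\<close>, \<open>2\<close>, \<open>3\<close>
  (with \<open>3 = 0\<close>). A function \<open>a\<close> has value \<open>a $ j\<close> at \<open>j\<close>; the ring operations on
  \<^typ>\<open>complex ^ 3\<close> are the componentwise ones.\<close>

type_synonym alg = "complex ^ 3"

definition scal :: "complex \<Rightarrow> alg" where
  "scal c = (\<chi> j. c)"

definition chi :: "3 \<Rightarrow> alg" where
  "chi i = (\<chi> j. if i = j then 1 else 0)"

definition alg_star :: "alg \<Rightarrow> alg" where
  "alg_star a = (\<chi> j. cnj (a $ j))"

text \<open>An operator on the sum of three copies of the plane is a matrix whose rows and columns are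
  indexed by (summand, coordinate). Summands 1, 2, 3 are those labelled 12, 23, 13.\<close>

type_synonym oper = "complex ^ (3 \<times> 2) ^ (3 \<times> 2)"

definition block_sum :: "complex^2^2 \<Rightarrow> complex^2^2 \<Rightarrow> complex^2^2 \<Rightarrow> oper" where
  "block_sum P Q R = (\<chi> r c. if fst r = fst c
     then (if fst r = 1 then P else if fst r = 2 then Q else R) $ snd r $ snd c else 0)"

definition rep :: "alg \<Rightarrow> oper" where
  "rep f = block_sum (vector [vector [f $ 1, 0], vector [0, f $ 2]])
                (vector [vector [f $ 2, 0], vector [0, f $ 3]])
                (vector [vector [f $ 1, 0], vector [0, f $ 3]])"

definition Dirac :: oper where
  "Dirac = block_sum (vector [vector [0, 1], vector [1, 0]])
                (vector [vector [0, 1], vector [1, 0]])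
                (vector [vector [0, 1], vector [1, 0]])"

definition comm_D :: "alg \<Rightarrow> oper" where
  "comm_D a = Dirac ** rep a - rep a ** Dirac"

lemma scal_simps [simp]:
  "scal 0 = 0" "scal 1 = 1" "scal (c + c') = scal c + scal c'" "scal (- c) = - scal c"
  "scal (c * c') = scal c * scal c'"
  by (simp_all add: scal_def vec_eq_iff)

lemma block_sum_add: "block_sum P Q R + block_sum P' Q' R' = block_sum (P + P') (Q + Q') (R + R')"
  by (simp add: block_sum_def vec_eq_iff)

lemma block_sum_mult: "block_sum P Q R ** block_sum P' Q' R' = block_sum (P ** P') (Q ** Q') (R ** R')"
proof -
  have "(\<Sum>k\<in>UNIV. block_sum P Q R $ r $ k * block_sum P' Q' R' $ k $ c)
      = (\<Sum>k1\<in>UNIV. \<Sum>k2\<in>UNIV. block_sum P Q R $ r $ (k1,k2) * block_sum P' Q' R' $ (k1,k2) $ c)" for r c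
    by (simp add: sum.cartesian_product flip: UNIV_Times_UNIV)
  then have "(block_sum P Q R ** block_sum P' Q' R') $ (i, k) $ (j, l)
      = block_sum (P ** P') (Q ** Q') (R ** R') $ (i, k) $ (j, l)" for i k j l
    using exhaust_3[of i] exhaust_3[of j]
    by (elim disjE) (simp_all add: matrix_matrix_mult_def block_sum_def sum_3 sum_2)
  then show ?thesis by (simp add: vec_eq_iff)
qed

lemma rep_add: "rep (a + b) = rep a + rep b"
  unfolding rep_def block_sum_add
  by (intro arg_cong3[where f=block_sum]) (simp_all add: vec_eq_iff forall_2)

lemma rep_mult: "rep (a * b) = rep a ** rep b"
  unfolding rep_def block_sum_mult
  by (intro arg_cong3[where f=block_sum]) (simp_all add: vec_eq_iff forall_2 matrix_matrix_mult_def sum_2)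

lemma rep_one: "rep 1 = mat 1"
  by (auto simp: rep_def block_sum_def mat_def vec_eq_iff forall_2 prod_eq_iff)

lemma rep_zero: "rep 0 = 0"
  using rep_add[of 0 0] by simp

lemma rep_minus: "rep (- a) = - rep a"
  using rep_add[of a "- a"] by (simp add: rep_zero eq_neg_iff_add_eq_0 add.commute)

lemma rep_scal: "rep (scal c) = mat c"
  by (auto simp: rep_def block_sum_def mat_def vec_eq_iff forall_2 prod_eq_iff scal_def)

lemma mat_commute: "mat c ** M = M ** (mat c :: oper)"
  by (simp add: vec_eq_iff matrix_matrix_mult_def mat_def if_distrib if_distribR sum.delta sum.delta' mult.commute cong: if_cong)

lemma oper_distrib:
  fixes M N P :: oper
  shows "(M + N) ** P = M ** P + N ** P" "M ** (N + P) = M ** N + M ** P"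
    "(M - N) ** P = M ** P - N ** P" "M ** (N - P) = M ** N - M ** P"
    "(- M) ** P = - (M ** P)" "M ** (- P) = - (M ** P)"
    "0 ** P = 0" "M ** 0 = 0"
  by (simp_all add: matrix_matrix_mult_def vec_eq_iff algebra_simps sum.distrib sum_subtractf sum_negf)

lemma comm_D_add: "comm_D (a + b) = comm_D a + comm_D b"
  by (simp add: comm_D_def rep_add oper_distrib)

lemma comm_D_mult: "comm_D (a * b) = comm_D a ** rep b + rep a ** comm_D b"
  by (simp add: comm_D_def rep_mult oper_distrib matrix_mul_assoc)

lemma comm_D_scal: "comm_D (scal c) = 0"
  by (simp add: comm_D_def rep_scal mat_commute)

section \<open>Tensor products\<close>

datatype ('m, 'n) tterm =
  TZero | TPure 'm 'n | TAdd "('m, 'n) tterm" "('m, 'n) tterm" | TNeg "('m, 'n) tterm"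

text \<open>The congruence on formal sums of pure tensors presenting the abelian group
  \<open>M \<otimes>\<^sub>R N\<close>, for a right action \<open>ra\<close> of \<open>R\<close> on \<open>M\<close> and a left action \<open>la\<close> of \<open>R\<close> on \<open>N\<close>.\<close>

inductive tcong ::
  "('m::ab_group_add \<Rightarrow> 'r \<Rightarrow> 'm) \<Rightarrow> ('r \<Rightarrow> 'n::ab_group_add \<Rightarrow> 'n) \<Rightarrow>
     ('m, 'n) tterm \<Rightarrow> ('m, 'n) tterm \<Rightarrow> bool"
  for ra :: "'m::ab_group_add \<Rightarrow> 'r \<Rightarrow> 'm" and la :: "'r \<Rightarrow> 'n::ab_group_add \<Rightarrow> 'n" where
  refl: "tcong ra la x x"
| sym: "tcong ra la x y \<Longrightarrow> tcong ra la y x"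
| trans: "tcong ra la x y \<Longrightarrow> tcong ra la y z \<Longrightarrow> tcong ra la x z"
| add_cong: "tcong ra la x x' \<Longrightarrow> tcong ra la y y' \<Longrightarrow> tcong ra la (TAdd x y) (TAdd x' y')"
| neg_cong: "tcong ra la x x' \<Longrightarrow> tcong ra la (TNeg x) (TNeg x')"
| add_assoc: "tcong ra la (TAdd (TAdd x y) z) (TAdd x (TAdd y z))"
| add_comm: "tcong ra la (TAdd x y) (TAdd y x)"
| add_zero: "tcong ra la (TAdd TZero x) x"
| add_neg: "tcong ra la (TAdd (TNeg x) x) TZero"
| left_add: "tcong ra la (TPure (m + m') n) (TAdd (TPure m n) (TPure m' n))"
| right_add: "tcong ra la (TPure m (n + n')) (TAdd (TPure m n) (TPure m n'))"
| balance: "tcong ra la (TPure (ra m r) n) (TPure m (la r n))"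

lemma equivp_tcong: "equivp (tcong ra la)"
  by (rule equivpI)
     (auto simp: reflp_def symp_def transp_def intro: tcong.refl tcong.sym tcong.trans)

primrec teval :: "('m \<Rightarrow> 'n \<Rightarrow> 'b::ab_group_add) \<Rightarrow> ('m, 'n) tterm \<Rightarrow> 'b" where
  "teval \<beta> TZero = 0"
| "teval \<beta> (TPure m n) = \<beta> m n"
| "teval \<beta> (TAdd x y) = teval \<beta> x + teval \<beta> y"
| "teval \<beta> (TNeg x) = - teval \<beta> x"

definition balanced ::
  "('m::ab_group_add \<Rightarrow> 'r \<Rightarrow> 'm) \<Rightarrow> ('r \<Rightarrow> 'n::ab_group_add \<Rightarrow> 'n) \<Rightarrow>
     ('m \<Rightarrow> 'n \<Rightarrow> 'b::ab_group_add) \<Rightarrow> bool" where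
  "balanced ra la \<beta> \<longleftrightarrow>
     (\<forall>m m' n. \<beta> (m + m') n = \<beta> m n + \<beta> m' n) \<and>
     (\<forall>m n n'. \<beta> m (n + n') = \<beta> m n + \<beta> m n') \<and>
     (\<forall>m r n. \<beta> (ra m r) n = \<beta> m (la r n))"

lemma teval_cong:
  "tcong ra la x y \<Longrightarrow> balanced ra la \<beta> \<Longrightarrow> teval \<beta> x = teval \<beta> y"
  by (induction rule: tcong.induct) (auto simp: balanced_def algebra_simps)

subsection \<open>The tensor square of the algebra over the complex numbers\<close>

quotient_type alg2 = "(alg, alg) tterm" / "tcong (\<lambda>a c. a * scal c) (\<lambda>c a. scal c * a)"
  by (rule equivp_tcong)

instantiation alg2 :: ab_group_add
begin
lift_definition zero_alg2 :: alg2 is TZero .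
lift_definition plus_alg2 :: "alg2 \<Rightarrow> alg2 \<Rightarrow> alg2" is TAdd by (rule tcong.add_cong)
lift_definition uminus_alg2 :: "alg2 \<Rightarrow> alg2" is TNeg by (rule tcong.neg_cong)
definition minus_alg2 :: "alg2 \<Rightarrow> alg2 \<Rightarrow> alg2" where "minus_alg2 x y = x + - y"
instance
  by standard
     (transfer, intro tcong.add_assoc tcong.add_comm tcong.add_zero tcong.add_neg
       | simp add: minus_alg2_def)+
end

lift_definition pure2 :: "alg \<Rightarrow> alg \<Rightarrow> alg2" is TPure .

text \<open>The additive map on the tensor product induced by a balanced map \<open>\<beta>\<close>.\<close>

definition lift2 :: "(alg \<Rightarrow> alg \<Rightarrow> 'b::ab_group_add) \<Rightarrow> alg2 \<Rightarrow> 'b" where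
  "lift2 \<beta> t = teval \<beta> (rep_alg2 t)"

abbreviation balanced2 :: "(alg \<Rightarrow> alg \<Rightarrow> 'b::ab_group_add) \<Rightarrow> bool" where
  "balanced2 \<equiv> balanced (\<lambda>a c. a * scal c) (\<lambda>c a. scal c * a)"

lemma lift2_abs: "balanced2 \<beta> \<Longrightarrow> lift2 \<beta> (abs_alg2 x) = teval \<beta> x"
  unfolding lift2_def
  by (rule teval_cong) (simp_all add: Quotient3_rep_abs[OF Quotient3_alg2] tcong.refl)

lemma alg2_induct [case_names zero pure add neg]:
  assumes "P 0" "\<And>a b. P (pure2 a b)" "\<And>x y. P x \<Longrightarrow> P y \<Longrightarrow> P (x + y)" "\<And>x. P x \<Longrightarrow> P (- x)"
  shows "P t"
proof -
  have "P (abs_alg2 x)" for x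
    by (induction x)
       (use assms in \<open>auto simp: zero_alg2_def pure2.abs_eq plus_alg2.abs_eq[symmetric] uminus_alg2.abs_eq[symmetric]\<close>)
  then show ?thesis by (induct t rule: alg2.abs_induct)
qed

context
  fixes \<beta> :: "alg \<Rightarrow> alg \<Rightarrow> 'b::ab_group_add"
  assumes bal: "balanced2 \<beta>"
begin
lemma lift2_zero: "lift2 \<beta> 0 = 0"
  using bal by (simp add: zero_alg2_def lift2_abs)
lemma lift2_pure: "lift2 \<beta> (pure2 a b) = \<beta> a b"
  using bal by (simp add: pure2.abs_eq lift2_abs)
lemma lift2_add: "lift2 \<beta> (x + y) = lift2 \<beta> x + lift2 \<beta> y"
  using bal by (induct x rule: alg2.abs_induct; induct y rule: alg2.abs_induct) (simp add: plus_alg2.abs_eq lift2_abs)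
lemma lift2_neg: "lift2 \<beta> (- x) = - lift2 \<beta> x"
  using bal by (induct x rule: alg2.abs_induct) (simp add: uminus_alg2.abs_eq lift2_abs)
lemmas lift2_simps = lift2_zero lift2_pure lift2_add lift2_neg
end


definition mult2 :: "alg2 \<Rightarrow> alg" where
  "mult2 = lift2 (*)"

definition lact2 :: "alg \<Rightarrow> alg2 \<Rightarrow> alg2" where
  "lact2 a = lift2 (\<lambda>b c. pure2 (a * b) c)"

definition ract2 :: "alg2 \<Rightarrow> alg \<Rightarrow> alg2" where
  "ract2 t a = lift2 (\<lambda>b c. pure2 b (c * a)) t"

lemma pure2_add: "pure2 (a + a') b = pure2 a b + pure2 a' b" "pure2 a (b + b') = pure2 a b + pure2 a b'"
  by (transfer, rule tcong.left_add tcong.right_add)+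

lemma pure2_balance: "pure2 (a * scal c) b = pure2 a (scal c * b)"
  by transfer (rule tcong.balance)

lemma balanced2_mult: "balanced2 (*)"
  by (simp add: balanced_def algebra_simps)

lemma balanced2_lact: "balanced2 (\<lambda>b c. pure2 (a * b) c)"
  by (simp add: balanced_def distrib_left pure2_add pure2_balance flip: mult.assoc)

lemma balanced2_ract: "balanced2 (\<lambda>b c. pure2 b (c * a))"
  by (simp add: balanced_def distrib_right pure2_add pure2_balance mult.assoc)

lemmas mult2_simps = lift2_simps[OF balanced2_mult, folded mult2_def]
lemmas lact2_simps = lift2_simps[OF balanced2_lact, folded lact2_def]
lemmas ract2_simps = lift2_simps[OF balanced2_ract, folded ract2_def]

lemma mult2_lact2: "mult2 (lact2 a t) = a * mult2 t"
  by (induct t rule: alg2_induct) (simp_all add: mult2_simps lact2_simps algebra_simps)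

lemma mult2_ract2: "mult2 (ract2 t a) = mult2 t * a"
  by (induct t rule: alg2_induct) (simp_all add: mult2_simps ract2_simps algebra_simps)

section \<open>The universal differential graded algebra\<close>

text \<open>The bimodule of universal 1-forms, with \<open>udiff0 a = 1 \<otimes> a - a \<otimes> 1\<close>.\<close>

typedef uform1 = "{t. mult2 t = 0}"
  by (rule exI[of _ 0]) (simp add: mult2_simps)

setup_lifting type_definition_uform1

instantiation uform1 :: ab_group_add
begin
lift_definition zero_uform1 :: uform1 is 0 by (simp add: mult2_simps)
lift_definition plus_uform1 :: "uform1 \<Rightarrow> uform1 \<Rightarrow> uform1" is "(+)" by (simp add: mult2_simps)
lift_definition uminus_uform1 :: "uform1 \<Rightarrow> uform1" is uminus by (simp add: mult2_simps)
lift_definition minus_uform1 :: "uform1 \<Rightarrow> uform1 \<Rightarrow> uform1" is "(-)"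
  by (simp add: mult2_simps diff_conv_add_uminus del: add_uminus_conv_diff)
instance by standard (transfer, simp)+
end

lift_definition ulact :: "alg \<Rightarrow> uform1 \<Rightarrow> uform1" is lact2 by (simp add: mult2_lact2)
lift_definition uract :: "uform1 \<Rightarrow> alg \<Rightarrow> uform1" is ract2 by (simp add: mult2_ract2)

lift_definition udiff0 :: "alg \<Rightarrow> uform1" is "\<lambda>a. pure2 1 a - pure2 a 1"
  by (simp add: mult2_simps diff_conv_add_uminus del: add_uminus_conv_diff)

datatype uterm = UAlg alg | UForm uform1 | UAdd uterm uterm | UNeg uterm | UMul uterm uterm

text \<open>The congruence presenting the tensor algebra of the bimodule \<^typ>\<open>uform1\<close> over \<^typ>\<open>alg\<close>: the
  ring generated by \<^typ>\<open>alg\<close> and \<^typ>\<open>uform1\<close> subject to the relations saying that \<^const>\<open>UAlg\<close> is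
  a unital ring homomorphism and \<^const>\<open>UForm\<close> a bimodule morphism.\<close>

inductive ucong :: "uterm \<Rightarrow> uterm \<Rightarrow> bool" where
  refl: "ucong x x"
| sym: "ucong x y \<Longrightarrow> ucong y x"
| trans: "ucong x y \<Longrightarrow> ucong y z \<Longrightarrow> ucong x z"
| add_cong: "ucong x x' \<Longrightarrow> ucong y y' \<Longrightarrow> ucong (UAdd x y) (UAdd x' y')"
| neg_cong: "ucong x x' \<Longrightarrow> ucong (UNeg x) (UNeg x')"
| mul_cong: "ucong x x' \<Longrightarrow> ucong y y' \<Longrightarrow> ucong (UMul x y) (UMul x' y')"
| add_assoc: "ucong (UAdd (UAdd x y) z) (UAdd x (UAdd y z))"
| add_comm: "ucong (UAdd x y) (UAdd y x)"
| add_zero: "ucong (UAdd (UAlg 0) x) x"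
| add_neg: "ucong (UAdd (UNeg x) x) (UAlg 0)"
| mul_assoc: "ucong (UMul (UMul x y) z) (UMul x (UMul y z))"
| one_mul: "ucong (UMul (UAlg 1) x) x"
| mul_one: "ucong (UMul x (UAlg 1)) x"
| distrib_right: "ucong (UMul (UAdd x y) z) (UAdd (UMul x z) (UMul y z))"
| distrib_left: "ucong (UMul x (UAdd y z)) (UAdd (UMul x y) (UMul x z))"
| alg_add: "ucong (UAlg (a + b)) (UAdd (UAlg a) (UAlg b))"
| alg_mul: "ucong (UAlg (a * b)) (UMul (UAlg a) (UAlg b))"
| form_add: "ucong (UForm (m + n)) (UAdd (UForm m) (UForm n))"
| form_lact: "ucong (UForm (ulact a m)) (UMul (UAlg a) (UForm m))"
| form_ract: "ucong (UForm (uract m a)) (UMul (UForm m) (UAlg a))"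

lemma equivp_ucong: "equivp ucong"
  by (rule equivpI)
     (auto simp: reflp_def symp_def transp_def intro: ucong.refl ucong.sym ucong.trans)

text \<open>On a 1-form \<open>\<Sum> a \<otimes> b\<close> the next map gives \<open>\<Sum> a [D, b]\<close>.\<close>

definition oper_of_form :: "uform1 \<Rightarrow> oper" where
  "oper_of_form m = lift2 (\<lambda>a b. rep a ** comm_D b) (Rep_uform1 m)"

primrec ueval :: "uterm \<Rightarrow> oper" where
  "ueval (UAlg a) = rep a"
| "ueval (UForm m) = oper_of_form m"
| "ueval (UAdd x y) = ueval x + ueval y"
| "ueval (UNeg x) = - ueval x"
| "ueval (UMul x y) = ueval x ** ueval y"

lemma balanced2_oper: "balanced2 (\<lambda>a b. rep a ** comm_D b)"
  by (simp add: balanced_def rep_add comm_D_add comm_D_mult comm_D_scal rep_mult oper_distrib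
        matrix_mul_assoc)

lemmas oper2_simps = lift2_simps[OF balanced2_oper]

lemma oper_of_form_add: "oper_of_form (m + n) = oper_of_form m + oper_of_form n"
  by (simp add: oper_of_form_def plus_uform1.rep_eq oper2_simps)

lemma oper_of_form_lact: "oper_of_form (ulact a m) = rep a ** oper_of_form m"
proof -
  let ?L = "lift2 (\<lambda>a b. rep a ** comm_D b)"
  have "?L (lact2 a t) = rep a ** ?L t" for t
    by (induct t rule: alg2_induct)
       (simp_all add: lact2_simps oper2_simps oper_distrib rep_mult matrix_mul_assoc)
  then show ?thesis by (simp add: oper_of_form_def ulact.rep_eq)
qed

lemma oper_of_form_ract: "oper_of_form (uract m a) = oper_of_form m ** rep a"
proof -
  let ?L = "lift2 (\<lambda>a b. rep a ** comm_D b)"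
  have "?L (ract2 t a) = ?L t ** rep a + rep (mult2 t) ** comm_D a" for t
    by (induct t rule: alg2_induct)
       (simp_all add: ract2_simps mult2_simps oper2_simps oper_distrib rep_mult matrix_mul_assoc
         comm_D_mult rep_zero rep_add rep_minus)
  then show ?thesis
    using Rep_uform1[of m] by (simp add: oper_of_form_def uract.rep_eq rep_zero oper_distrib)
qed

lemma ueval_cong: "ucong x y \<Longrightarrow> ueval x = ueval y"
  by (induct rule: ucong.induct)
     (simp_all add: oper_distrib rep_add rep_mult rep_zero rep_one matrix_mul_assoc
        oper_of_form_add oper_of_form_lact oper_of_form_ract)

quotient_type univ = uterm / ucong
  by (rule equivp_ucong)

instantiation univ :: ring_1
begin
lift_definition zero_univ :: univ is "UAlg 0" .
lift_definition one_univ :: univ is "UAlg 1" .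
lift_definition plus_univ :: "univ \<Rightarrow> univ \<Rightarrow> univ" is UAdd by (rule ucong.add_cong)
lift_definition uminus_univ :: "univ \<Rightarrow> univ" is UNeg by (rule ucong.neg_cong)
lift_definition times_univ :: "univ \<Rightarrow> univ \<Rightarrow> univ" is UMul by (rule ucong.mul_cong)
definition minus_univ :: "univ \<Rightarrow> univ \<Rightarrow> univ" where "minus_univ x y = x + - y"
instance
proof
  show "(0::univ) \<noteq> 1"
  proof (transfer, rule notI)
    assume "ucong (UAlg 0) (UAlg 1)"
    then have "rep 0 = rep 1" using ueval_cong by fastforce
    then have "(mat 1 :: oper) = 0"
      by (simp add: rep_zero rep_one)
    then have "(mat 1 :: oper) $ (1, 1) $ (1, 1) = 0"
      by (metis zero_index)
    then show False by (simp add: mat_def)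
  qed
qed (transfer, intro ucong.intros(7-15) | simp add: minus_univ_def)+
end

lift_definition ualg :: "alg \<Rightarrow> univ" is UAlg .
lift_definition uform :: "uform1 \<Rightarrow> univ" is UForm .

text \<open>The lemmas \<open>pi_u_simps\<close> and \<open>pi_u_dA\<close> below give
  \<open>\<pi>\<^sub>u(a\<^sub>0 da\<^sub>1 \<cdots> da\<^sub>p) = a\<^sub>0 [D, a\<^sub>1] \<cdots> [D, a\<^sub>p]\<close>.\<close>

lift_definition pi_u :: "univ \<Rightarrow> oper" is ueval by (rule ueval_cong)

lemma univ_induct [case_names alg form add neg mult]:
  assumes "\<And>a. P (ualg a)" "\<And>m. P (uform m)" "\<And>x y. P x \<Longrightarrow> P y \<Longrightarrow> P (x + y)"
    "\<And>x. P x \<Longrightarrow> P (- x)" "\<And>x y. P x \<Longrightarrow> P y \<Longrightarrow> P (x * y)"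
  shows "P w"
proof -
  have "P (abs_univ x)" for x
    by (induction x)
       (use assms in \<open>auto simp: ualg.abs_eq[symmetric] uform.abs_eq[symmetric]
          plus_univ.abs_eq[symmetric] uminus_univ.abs_eq[symmetric] times_univ.abs_eq[symmetric]\<close>)
  then show ?thesis by (induct w rule: univ.abs_induct)
qed

lemma ualg_simps: "ualg (a + b) = ualg a + ualg b" "ualg (a * b) = ualg a * ualg b"
  "ualg 0 = 0" "ualg 1 = 1"
  by (transfer, rule ucong.alg_add ucong.alg_mul ucong.refl)+

lemma ualg_minus: "ualg (- a) = - ualg a"
  using ualg_simps(1)[of a "- a"] by (simp add: ualg_simps eq_neg_iff_add_eq_0 add.commute)

lemma uform_simps: "uform (m + n) = uform m + uform n" "uform (ulact a m) = ualg a * uform m"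
  "uform (uract m a) = uform m * ualg a"
  by (transfer, rule ucong.form_add ucong.form_lact ucong.form_ract)+

lemma uform_zero: "uform 0 = 0"
  using uform_simps(1)[of 0 0] by simp

lemma uform_minus: "uform (- m) = - uform m"
  using uform_simps(1)[of m "- m"] by (simp add: uform_zero eq_neg_iff_add_eq_0 add.commute)

lemma pi_u_simps: "pi_u (ualg a) = rep a" "pi_u (uform m) = oper_of_form m"
  "pi_u (x + y) = pi_u x + pi_u y" "pi_u (- x) = - pi_u x" "pi_u (x * y) = pi_u x ** pi_u y"
  by (transfer, simp)+


lemma pi_u_dA: "pi_u (uform (udiff0 a)) = comm_D a"
proof -
  let ?L = "lift2 (\<lambda>a b. rep a ** comm_D b)"
  have "comm_D 1 = 0" using comm_D_scal[of 1] by simp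
  moreover have "?L (pure2 1 a + - pure2 a 1) = rep 1 ** comm_D a + - (rep a ** comm_D 1)"
    by (simp only: oper2_simps)
  ultimately show ?thesis
    by (simp add: pi_u_simps oper_of_form_def udiff0.rep_eq rep_one oper_distrib)
qed

subsection \<open>The grading\<close>

text \<open>\<open>udeg p w\<close>: the universal form \<open>w\<close> is homogeneous of degree \<open>p\<close>.\<close>

inductive udeg :: "nat \<Rightarrow> univ \<Rightarrow> bool" where
  zero: "udeg p 0"
| alg: "udeg 0 (ualg a)"
| form: "udeg 1 (uform m)"
| add: "udeg p x \<Longrightarrow> udeg p y \<Longrightarrow> udeg p (x + y)"
| mult: "udeg p x \<Longrightarrow> udeg q y \<Longrightarrow> udeg (p + q) (x * y)"

lemma udeg_neg: "udeg p x \<Longrightarrow> udeg p (- x)"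
  using udeg.mult[OF udeg.alg[of "- 1"], of p x] by (simp add: ualg_minus ualg_simps)

lemma udeg_diff: "udeg p x \<Longrightarrow> udeg p y \<Longrightarrow> udeg p (x - y)"
  using udeg.add[OF _ udeg_neg, of p x y] by simp

lemma udeg_sign: "udeg p x \<Longrightarrow> udeg p ((-1) ^ k * x)"
  by (cases "even k") (simp_all add: udeg_neg)

inductive hspan :: "univ \<Rightarrow> bool" where
  hom: "udeg p x \<Longrightarrow> hspan x"
| add: "hspan x \<Longrightarrow> hspan y \<Longrightarrow> hspan (x + y)"

lemma hspan_mult_hom: "hspan y \<Longrightarrow> udeg p x \<Longrightarrow> hspan (x * y)"
  by (induct rule: hspan.induct) (simp_all add: ring_distribs hspan.add hspan.hom[OF udeg.mult])

lemma hspan_mult: "hspan x \<Longrightarrow> hspan y \<Longrightarrow> hspan (x * y)"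
  by (induct rule: hspan.induct) (simp_all add: ring_distribs hspan.add hspan_mult_hom)

lemma hspan_neg: "hspan x \<Longrightarrow> hspan (- x)"
  using hspan_mult_hom[OF _ udeg.alg[of "- 1"]] by (simp add: ualg_minus ualg_simps)

lemma hspan_all: "hspan w"
  by (induct w rule: univ_induct)
     (auto intro: hspan.intros udeg.intros hspan_mult hspan_neg simp del: One_nat_def)

lemma univ_hom_induct [case_names hom add]:
  assumes "\<And>p x. udeg p x \<Longrightarrow> P x" "\<And>x y. P x \<Longrightarrow> P y \<Longrightarrow> P (x + y)"
  shows "P w"
  using hspan_all[of w] by induct (use assms in auto)

subsection \<open>The universal differential\<close>

definition univ_differential :: "(univ \<Rightarrow> univ) \<Rightarrow> bool" where
  "univ_differential d \<longleftrightarrow>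
     (\<forall>x y. d (x + y) = d x + d y) \<and>
     (\<forall>p x. udeg p x \<longrightarrow> udeg (Suc p) (d x)) \<and>
     (\<forall>p x y. udeg p x \<longrightarrow> d (x * y) = d x * y + (-1) ^ p * x * d y) \<and>
     (\<forall>x. d (d x) = 0) \<and>
     (\<forall>a. d (ualg a) = uform (udiff0 a))"

definition udiff :: "univ \<Rightarrow> univ" where
  "udiff = (THE d. univ_differential d)"

text \<open>Existence and uniqueness of \<^const>\<open>udiff\<close> are established next.\<close>

lemma lact2_diff: "lact2 a (x - y) = lact2 a x - lact2 a y"
  by (simp add: diff_conv_add_uminus lact2_simps del: add_uminus_conv_diff)

lemma ract2_diff: "ract2 (x - y) a = ract2 x a - ract2 y a"
  by (simp add: diff_conv_add_uminus ract2_simps del: add_uminus_conv_diff)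

lemma udiff0_add: "udiff0 (a + b) = udiff0 a + udiff0 b"
  by transfer (simp add: pure2_add)

lemma udiff0_mult: "udiff0 (a * b) = uract (udiff0 a) b + ulact a (udiff0 b)"
  by transfer (simp add: lact2_diff ract2_diff lact2_simps ract2_simps)

lemma udiff0_scal: "udiff0 (scal c) = 0"
proof -
  have "pure2 1 (scal c) = pure2 (scal c) 1" using pure2_balance[of 1 c 1] by simp
  then show ?thesis by transfer simp
qed

abbreviation dA :: "alg \<Rightarrow> univ" where "dA a \<equiv> uform (udiff0 a)"

lemma dA_add: "dA (a + b) = dA a + dA b"
  by (simp add: udiff0_add uform_simps)

lemma dA_mult: "dA (a * b) = dA a * ualg b + ualg a * dA b"
  by (simp add: udiff0_mult uform_simps)

lemma dA_scal: "dA (scal c) = 0"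
  by (simp add: udiff0_scal uform_zero)

lemma dA_zero: "dA 0 = 0" and dA_one: "dA 1 = 0"
  using dA_scal[of 0] dA_scal[of 1] by simp_all

lemma dA_minus: "dA (- a) = - dA a"
  using dA_add[of a "- a"] by (simp add: dA_zero eq_neg_iff_add_eq_0 add.commute)

lemma dA_scal_commute: "ualg (scal c) * dA a = dA a * ualg (scal c)"
  using dA_mult[of "scal c" a] dA_mult[of a "scal c"] by (simp add: dA_scal mult.commute[of a])

lemma balanced2_form: "balanced2 (\<lambda>a b. ualg a * dA b)"
  by (simp add: balanced_def dA_add dA_mult dA_scal dA_scal_commute ualg_simps ring_distribs mult.assoc)

lemma balanced2_curv: "balanced2 (\<lambda>a b. dA a * dA b)"
  by (simp add: balanced_def dA_add dA_mult dA_scal dA_scal_commute ualg_simps ring_distribs mult.assoc)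

lemmas form2_simps = lift2_simps[OF balanced2_form]
lemmas curv2_simps = lift2_simps[OF balanced2_curv]

lemma uform_eq_lift2: "uform m = lift2 (\<lambda>a b. ualg a * dA b) (Rep_uform1 m)"
proof -
  let ?k = "\<lambda>t. Abs_uform1 (t - pure2 (mult2 t) 1)"
  have p0: "pure2 0 1 = 0"
    using pure2_add(1)[of 0 0 1] by simp
  have pm: "pure2 (- a) 1 = - pure2 a 1" for a
    using pure2_add(1)[of a "- a" 1] by (simp add: p0 eq_neg_iff_add_eq_0 add.commute)
  have rep: "Rep_uform1 (?k t) = t - pure2 (mult2 t) 1" for t
    by (rule Abs_uform1_inverse)
       (simp add: mult2_simps diff_conv_add_uminus del: add_uminus_conv_diff)
  have add: "?k (x + y) = ?k x + ?k y" for x y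
  proof -
    have "Rep_uform1 (?k (x + y)) = Rep_uform1 (?k x + ?k y)"
      unfolding plus_uform1.rep_eq rep by (simp add: mult2_simps pure2_add)
    then show ?thesis by (simp only: Rep_uform1_inject)
  qed
  have neg: "?k (- x) = - ?k x" for x
  proof -
    have "Rep_uform1 (?k (- x)) = Rep_uform1 (- ?k x)"
      unfolding uminus_uform1.rep_eq rep by (simp add: mult2_simps pm)
    then show ?thesis by (simp only: Rep_uform1_inject)
  qed
  have pure: "?k (pure2 a b) = ulact a (udiff0 b)" for a b
  proof -
    have "Rep_uform1 (?k (pure2 a b)) = Rep_uform1 (ulact a (udiff0 b))"
      unfolding rep ulact.rep_eq udiff0.rep_eq
      by (simp add: mult2_simps lact2_diff lact2_simps)
    then show ?thesis by (simp only: Rep_uform1_inject)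
  qed
  have zero: "?k 0 = 0"
  proof -
    have "Rep_uform1 (?k 0) = Rep_uform1 0"
      unfolding rep zero_uform1.rep_eq by (simp add: mult2_simps p0)
    then show ?thesis by (simp only: Rep_uform1_inject)
  qed
  have "uform (?k t) = lift2 (\<lambda>a b. ualg a * dA b) t" for t
    by (induct t rule: alg2_induct)
       (simp_all only: add neg pure zero uform_simps uform_zero uform_minus form2_simps)
  from this[of "Rep_uform1 m"] show ?thesis
    using Rep_uform1[of m] by (simp add: p0 Rep_uform1_inverse)
qed

definition curv :: "uform1 \<Rightarrow> univ" where
  "curv m = lift2 (\<lambda>a b. dA a * dA b) (Rep_uform1 m)"

lemma curv_add: "curv (m + n) = curv m + curv n"
  by (simp add: curv_def plus_uform1.rep_eq curv2_simps)

lemma curv_lact: "curv (ulact a m) = dA a * uform m + ualg a * curv m"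
proof -
  have "lift2 (\<lambda>a b. dA a * dA b) (lact2 a t)
      = dA a * lift2 (\<lambda>a b. ualg a * dA b) t + ualg a * lift2 (\<lambda>a b. dA a * dA b) t" for t
    by (induct t rule: alg2_induct)
       (simp_all add: lact2_simps curv2_simps form2_simps dA_mult ring_distribs mult.assoc)
  then show ?thesis by (simp add: curv_def ulact.rep_eq uform_eq_lift2[of m])
qed

lemma curv_ract: "curv (uract m a) = curv m * ualg a - uform m * dA a"
proof -
  have "lift2 (\<lambda>a b. dA a * dA b) (ract2 t a) = lift2 (\<lambda>a b. dA a * dA b) t * ualg a
      + dA (mult2 t) * dA a - lift2 (\<lambda>a b. ualg a * dA b) t * dA a" for t
    by (induct t rule: alg2_induct)
       (simp_all add: ract2_simps curv2_simps form2_simps mult2_simps dA_mult dA_add dA_zero dA_minus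
          ring_distribs mult.assoc)
  then show ?thesis
    using Rep_uform1[of m] by (simp add: curv_def uract.rep_eq uform_eq_lift2[of m] dA_zero)
qed

lemma abs_univ_simps: "abs_univ (UAlg a) = ualg a" "abs_univ (UForm m) = uform m"
  "abs_univ (UAdd x y) = abs_univ x + abs_univ y" "abs_univ (UNeg x) = - abs_univ x"
  "abs_univ (UMul x y) = abs_univ x * abs_univ y"
  by (simp_all add: ualg.abs_eq uform.abs_eq plus_univ.abs_eq uminus_univ.abs_eq times_univ.abs_eq)

text \<open>The grading automorphism, acting by \<open>(-1)\<^sup>p\<close> in degree \<open>p\<close>.\<close>

primrec geval :: "uterm \<Rightarrow> univ" where
  "geval (UAlg a) = ualg a"
| "geval (UForm m) = - uform m"
| "geval (UAdd x y) = geval x + geval y"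
| "geval (UNeg x) = - geval x"
| "geval (UMul x y) = geval x * geval y"

lemma geval_cong: "ucong x y \<Longrightarrow> geval x = geval y"
  by (induct rule: ucong.induct) (simp_all add: ualg_simps uform_simps algebra_simps)

lift_definition grad :: "univ \<Rightarrow> univ" is geval by (rule geval_cong)

lemma grad_simps: "grad (ualg a) = ualg a" "grad (uform m) = - uform m"
  "grad (x + y) = grad x + grad y" "grad (- x) = - grad x" "grad (x * y) = grad x * grad y"
proof -
  show "grad (ualg a) = ualg a" "grad (uform m) = - uform m"
    by (simp_all add: grad.abs_eq ualg.abs_eq uform.abs_eq flip: abs_univ_simps(3-))
  show "grad (x + y) = grad x + grad y" "grad (- x) = - grad x" "grad (x * y) = grad x * grad y"
    by (induct x rule: univ.abs_induct; induct y rule: univ.abs_induct;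
        simp add: grad.abs_eq flip: abs_univ_simps(3-))+
qed

lemma grad_one: "grad 1 = 1"
  using grad_simps(1)[of 1] by (simp add: ualg_simps)

lemma grad_deg: "udeg p x \<Longrightarrow> grad x = (-1) ^ p * x"
proof (induct rule: udeg.induct)
  case (zero p)
  then show ?case using grad_simps(1)[of 0] by (simp add: ualg_simps)
next
  case (mult p x q y)
  have "grad (x * y) = (-1) ^ p * (x * ((-1) ^ q * y))"
    using mult by (simp add: grad_simps mult.assoc)
  then show ?case by (cases "even p"; cases "even q") simp_all
qed (simp_all add: grad_simps algebra_simps)

lemma grad_grad: "grad (grad x) = x"
  by (induct x rule: univ_induct) (simp_all add: grad_simps)

primrec deval :: "uterm \<Rightarrow> univ" where
  "deval (UAlg a) = dA a"
| "deval (UForm m) = curv m"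
| "deval (UAdd x y) = deval x + deval y"
| "deval (UNeg x) = - deval x"
| "deval (UMul x y) = deval x * abs_univ y + grad (abs_univ x) * deval y"

lemma deval_cong: "ucong x y \<Longrightarrow> deval x = deval y"
proof (induct rule: ucong.induct)
  case (mul_cong x x' y y')
  then show ?case by (simp add: univ.abs_eq_iff[THEN iffD2])
qed (simp_all add: abs_univ_simps ualg_simps grad_simps dA_add dA_mult dA_zero dA_one curv_add curv_lact
      curv_ract grad_one algebra_simps)

lift_definition udiff' :: "univ \<Rightarrow> univ" is deval by (rule deval_cong)

lemma udiff'_simps: "udiff' (ualg a) = dA a" "udiff' (uform m) = curv m"
  "udiff' (x + y) = udiff' x + udiff' y" "udiff' (- x) = - udiff' x"
  "udiff' (x * y) = udiff' x * y + grad x * udiff' y"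
proof -
  show "udiff' (ualg a) = dA a" "udiff' (uform m) = curv m"
    by (simp_all add: udiff'.abs_eq ualg.abs_eq uform.abs_eq)
  show "udiff' (x + y) = udiff' x + udiff' y" "udiff' (- x) = - udiff' x"
    "udiff' (x * y) = udiff' x * y + grad x * udiff' y"
    by (induct x rule: univ.abs_induct; induct y rule: univ.abs_induct;
        simp add: udiff'.abs_eq flip: abs_univ_simps(3-))+
qed

lemma curv_deg: "udeg 2 (curv m)"
proof -
  have "udeg 2 (lift2 (\<lambda>a b. dA a * dA b) t)" for t
    by (induct t rule: alg2_induct)
       (use udeg.mult[OF udeg.form udeg.form] in \<open>auto simp: curv2_simps numeral_2_eq_2 intro: udeg.intros udeg_neg\<close>)
  then show ?thesis by (simp add: curv_def)
qed

lemma grad_udiff': "grad (udiff' x) = - udiff' (grad x)"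
  by (induct x rule: univ_induct)
     (use grad_deg[OF curv_deg] in \<open>simp_all add: udiff'_simps grad_simps algebra_simps\<close>)

lemma udiff'_dA: "udiff' (dA a) = 0"
  by (simp add: udiff'_simps curv_def udiff0.rep_eq curv2_simps dA_one diff_conv_add_uminus
      del: add_uminus_conv_diff)

lemma udiff'_curv: "udiff' (curv m) = 0"
proof -
  have "udiff' 0 = 0" using udiff'_simps(1)[of 0] by (simp add: dA_zero ualg_simps)
  then have "udiff' (lift2 (\<lambda>a b. dA a * dA b) t) = 0" for t
    by (induct t rule: alg2_induct)
       (simp_all only: curv2_simps udiff'_simps(3-5) udiff'_dA, simp_all)
  then show ?thesis by (simp add: curv_def)
qed

lemma udiff'_udiff': "udiff' (udiff' x) = 0"
proof (induct x rule: univ_induct)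
  case (alg a)
  then show ?case using udiff'_dA[of a] by (simp add: udiff'_simps(1))
next
  case (form m)
  then show ?case using udiff'_curv[of m] by (simp add: udiff'_simps(2))
next
  case (mult x y)
  then show ?case by (simp add: udiff'_simps(3-5) grad_udiff' grad_grad)
qed (simp_all add: udiff'_simps(3-5))

lemma udiff'_deg: "udeg p x \<Longrightarrow> udeg (Suc p) (udiff' x)"
proof (induct rule: udeg.induct)
  case (zero p)
  then show ?case using udiff'_simps(1)[of 0] by (simp add: dA_zero ualg_simps udeg.zero)
next
  case (alg a)
  then show ?case using udeg.form by (simp add: udiff'_simps)
next
  case (form m)
  then show ?case using curv_deg by (simp add: udiff'_simps numeral_2_eq_2)
next
  case (add p x y)
  then show ?case by (simp add: udiff'_simps udeg.add)
next
  case (mult p x q y)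
  have "udeg (Suc p + q) (udiff' x * y)" "udeg (p + Suc q) (grad x * udiff' y)"
    using mult by (simp_all only: grad_deg udeg_sign udeg.mult)
  then show ?case by (simp add: udiff'_simps udeg.add)
qed

lemma univ_differential_udiff': "univ_differential udiff'"
  unfolding univ_differential_def
  by (simp add: udiff'_simps(1,3,5) udiff'_deg udiff'_udiff' grad_deg)

lemma univ_differential_unique:
  assumes "univ_differential d" "univ_differential d'"
  shows "d = d'"
proof -
  have *: "d (uform m) = curv m" if d: "univ_differential d" for d m
  proof -
    have add: "d (x + y) = d x + d y" for x y
      using d by (simp add: univ_differential_def)
    have zero: "d 0 = 0" using add[of 0 0] by simp
    have neg: "d (- x) = - d x" for x
      using add[of x "- x"] by (simp add: zero eq_neg_iff_add_eq_0 add.commute)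
    have pure: "d (ualg a * dA b) = dA a * dA b" for a b
    proof -
      have "d (dA b) = 0" using d by (metis univ_differential_def)
      moreover have "d (ualg a * dA b) = d (ualg a) * dA b + (-1) ^ 0 * ualg a * d (dA b)"
        using d udeg.alg[of a] unfolding univ_differential_def by blast
      moreover have "d (ualg a) = dA a" using d by (simp add: univ_differential_def)
      ultimately show ?thesis by simp
    qed
    have "d (lift2 (\<lambda>a b. ualg a * dA b) t) = lift2 (\<lambda>a b. dA a * dA b) t" for t
      by (induct t rule: alg2_induct) (simp_all add: curv2_simps form2_simps add zero neg pure)
    then show ?thesis by (simp add: uform_eq_lift2[of m] curv_def)
  qed
  have "d x = d' x" for x
  proof (induct x rule: univ_hom_induct)
    case (hom p x)
    then show ?case
    proof (induct rule: udeg.induct)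
      case (zero p)
      have "d (0 + 0) = d 0 + d 0" "d' (0 + 0) = d' 0 + d' 0"
        using assms unfolding univ_differential_def by blast+
      then show ?case by simp
    next
      case (mult p x q y)
      have "d (x * y) = d x * y + (-1) ^ p * x * d y" "d' (x * y) = d' x * y + (-1) ^ p * x * d' y"
        using assms mult(1) unfolding univ_differential_def by blast+
      with mult show ?case by simp
    qed (use assms *[OF assms(1)] *[OF assms(2)] in \<open>simp_all add: univ_differential_def\<close>)
  qed (use assms in \<open>simp add: univ_differential_def\<close>)
  then show ?thesis by blast
qed

lemma univ_differential_udiff: "univ_differential udiff"
  unfolding udiff_def
  by (rule theI[of univ_differential, OF univ_differential_udiff'])
     (rule univ_differential_unique[OF _ univ_differential_udiff'])


lemma udiff_eq: "udiff = udiff'"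
  by (rule univ_differential_unique[OF univ_differential_udiff univ_differential_udiff'])

lemmas udiff_simps = udiff'_simps[folded udiff_eq]
lemmas udiff_udiff = udiff'_udiff'[folded udiff_eq]
lemmas udiff_deg = udiff'_deg[folded udiff_eq]
lemmas grad_udiff = grad_udiff'[folded udiff_eq]

lemma udiff_zero: "udiff 0 = 0"
  using udiff_simps(3)[of 0 0] by simp

section \<open>Connes forms\<close>

definition J0_deg :: "nat \<Rightarrow> univ set" where
  "J0_deg p = {w. udeg p w \<and> pi_u w = 0}"

definition J0 :: "univ set" where
  "J0 = {\<Sum>p<n. f p | n f. \<forall>p. f p \<in> J0_deg p}"

definition Jid :: "univ set" where
  "Jid = {x + udiff y | x y. x \<in> J0 \<and> y \<in> J0}"

lemma pi_u_zero: "pi_u 0 = 0"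
  using pi_u_simps(3)[of 0 0] by simp

lemma J0_deg_add: "x \<in> J0_deg p \<Longrightarrow> y \<in> J0_deg p \<Longrightarrow> x + y \<in> J0_deg p"
  by (simp add: J0_deg_def udeg.add pi_u_simps)

lemma J0_deg_zero: "0 \<in> J0_deg p"
  by (simp add: J0_deg_def udeg.zero pi_u_zero)

lemma J0_hom: assumes "x \<in> J0_deg p" shows "x \<in> J0"
proof -
  have "x = (\<Sum>q<Suc p. if q = p then x else 0)" by simp
  moreover have "\<forall>q. (if q = p then x else 0) \<in> J0_deg q"
    using assms J0_deg_zero by simp
  ultimately show ?thesis unfolding J0_def by blast
qed

lemma J0_add: assumes "x \<in> J0" "y \<in> J0" shows "x + y \<in> J0"
proof -
  obtain n f m g where f: "x = (\<Sum>p<n. f p)" "\<forall>p. f p \<in> J0_deg p"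
    and g: "y = (\<Sum>p<m. g p)" "\<forall>p. g p \<in> J0_deg p"
    using assms unfolding J0_def by blast
  let ?f = "\<lambda>p. (if p < n then f p else 0) + (if p < m then g p else 0)"
  have "(\<Sum>p<max n m. if p < n then f p else 0) = x"
    unfolding f(1) by (rule sum.mono_neutral_cong_right) auto
  moreover have "(\<Sum>p<max n m. if p < m then g p else 0) = y"
    unfolding g(1) by (rule sum.mono_neutral_cong_right) auto
  ultimately have "x + y = (\<Sum>p<max n m. ?f p)"
    by (simp add: sum.distrib)
  moreover have "\<forall>p. ?f p \<in> J0_deg p"
    using f(2) g(2) by (intro allI J0_deg_add) (auto simp: J0_deg_zero)
  ultimately show ?thesis unfolding J0_def by blast
qed

lemma J0_zero: "0 \<in> J0"
  using J0_hom[OF J0_deg_zero] .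

lemma J0_induct [consumes 1, case_names hom add]:
  assumes "x \<in> J0" "\<And>p x. x \<in> J0_deg p \<Longrightarrow> P x" "\<And>x y. P x \<Longrightarrow> P y \<Longrightarrow> P (x + y)"
  shows "P x"
proof -
  obtain n f where f: "x = (\<Sum>p<n. f p)" "\<forall>p. f p \<in> J0_deg p"
    using assms(1) unfolding J0_def by blast
  have "P (\<Sum>p<n. f p)"
  proof (induct n)
    case 0
    then show ?case using assms(2)[OF J0_deg_zero] by simp
  next
    case (Suc n)
    then show ?case using assms(3)[OF Suc assms(2), of "f n" n] f(2) by (simp add: add.commute)
  qed
  then show ?thesis using f by simp
qed

lemma J0_mult_left: "x \<in> J0 \<Longrightarrow> w * x \<in> J0"
proof (induct w rule: univ_hom_induct)
  case (hom q w)
  from hom(2) show ?case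
  proof (induct rule: J0_induct)
    case (hom p x)
    have "w * x \<in> J0_deg (q + p)"
      using hom \<open>udeg q w\<close> by (simp add: J0_deg_def udeg.mult pi_u_simps oper_distrib)
    then show ?case by (rule J0_hom)
  qed (simp add: J0_add ring_distribs)
qed (simp add: J0_add ring_distribs)

lemma J0_mult_right: "x \<in> J0 \<Longrightarrow> x * w \<in> J0"
proof (induct w rule: univ_hom_induct)
  case (hom q w)
  from hom(2) show ?case
  proof (induct rule: J0_induct)
    case (hom p x)
    have "x * w \<in> J0_deg (p + q)"
      using hom \<open>udeg q w\<close> by (simp add: J0_deg_def udeg.mult pi_u_simps oper_distrib)
    then show ?case by (rule J0_hom)
  qed (simp add: J0_add ring_distribs)
qed (simp add: J0_add ring_distribs)

lemma J0_neg: "x \<in> J0 \<Longrightarrow> - x \<in> J0"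
  using J0_mult_left[of x "- 1"] by simp

lemma J0_grad: "x \<in> J0 \<Longrightarrow> grad x \<in> J0"
proof (induct rule: J0_induct)
  case (hom p x)
  then have "grad x = (-1) ^ p * x" by (simp add: J0_deg_def grad_deg)
  then show ?case using J0_mult_left[OF J0_hom[OF hom]] by simp
qed (simp add: J0_add grad_simps)

lemma udiff_minus: "udiff (x - y) = udiff x - udiff y"
  by (simp add: diff_conv_add_uminus udiff_simps del: add_uminus_conv_diff)

lemma J0_sub_Jid: "x \<in> J0 \<Longrightarrow> x \<in> Jid"
  unfolding Jid_def using J0_zero udiff_zero by (metis (mono_tags, lifting) CollectI add.right_neutral)

lemma udiff_J0_sub_Jid: "x \<in> J0 \<Longrightarrow> udiff x \<in> Jid"
  unfolding Jid_def using J0_zero by (metis (mono_tags, lifting) CollectI add.left_neutral)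

lemma Jid_add: assumes "x \<in> Jid" "y \<in> Jid" shows "x + y \<in> Jid"
proof -
  obtain a b c e where "x = a + udiff b" "y = c + udiff e" "a \<in> J0" "b \<in> J0" "c \<in> J0" "e \<in> J0"
    using assms unfolding Jid_def by blast
  then have "x + y = (a + c) + udiff (b + e)" "a + c \<in> J0" "b + e \<in> J0"
    by (simp_all add: udiff_simps J0_add)
  then show ?thesis unfolding Jid_def by blast
qed

lemma Jid_mult_left: assumes "x \<in> Jid" shows "w * x \<in> Jid"
proof -
  obtain a b where x: "x = a + udiff b" and ab: "a \<in> J0" "b \<in> J0"
    using assms unfolding Jid_def by blast
  have "w * x = (w * a - udiff (grad w) * b) + udiff (grad w * b)"
    by (simp add: x udiff_simps grad_grad algebra_simps)
  moreover have "w * a - udiff (grad w) * b \<in> J0"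
    using ab by (metis J0_add J0_neg J0_mult_left diff_conv_add_uminus)
  moreover have "grad w * b \<in> J0" using ab by (simp add: J0_mult_left)
  ultimately show ?thesis unfolding Jid_def by blast
qed

lemma Jid_mult_right: assumes "x \<in> Jid" shows "x * w \<in> Jid"
proof -
  obtain a b where x: "x = a + udiff b" and ab: "a \<in> J0" "b \<in> J0"
    using assms unfolding Jid_def by blast
  have "x * w = (a * w - grad b * udiff w) + udiff (b * w)"
    by (simp add: x udiff_simps algebra_simps)
  moreover have "a * w - grad b * udiff w \<in> J0"
    using ab by (metis J0_add J0_neg J0_mult_right J0_grad diff_conv_add_uminus)
  moreover have "b * w \<in> J0" using ab by (simp add: J0_mult_right)
  ultimately show ?thesis unfolding Jid_def by blast
qed

lemma Jid_neg: "x \<in> Jid \<Longrightarrow> - x \<in> Jid"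
  using Jid_mult_left[of x "- 1"] by simp

lemma Jid_zero: "0 \<in> Jid"
  by (rule J0_sub_Jid[OF J0_zero])

lemma Jid_udiff: assumes "x \<in> Jid" shows "udiff x \<in> Jid"
proof -
  obtain a b where x: "x = a + udiff b" and ab: "a \<in> J0" "b \<in> J0"
    using assms unfolding Jid_def by blast
  then have "udiff x = udiff a" by (simp add: udiff_simps udiff_udiff)
  then show ?thesis using ab by (simp add: udiff_J0_sub_Jid)
qed

text \<open>The degree zero part, used to see that the quotient by \<^const>\<open>Jid\<close> is not trivial.\<close>

primrec eval0 :: "uterm \<Rightarrow> alg" where
  "eval0 (UAlg a) = a"
| "eval0 (UForm m) = 0"
| "eval0 (UAdd x y) = eval0 x + eval0 y"
| "eval0 (UNeg x) = - eval0 x"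
| "eval0 (UMul x y) = eval0 x * eval0 y"

lift_definition part0 :: "univ \<Rightarrow> alg" is eval0
  by (erule ucong.induct) (simp_all add: algebra_simps)

lemma part0_simps: "part0 (ualg a) = a" "part0 (uform m) = 0" "part0 (x + y) = part0 x + part0 y"
  "part0 (- x) = - part0 x" "part0 (x * y) = part0 x * part0 y"
  by (transfer, simp)+

lemma part0_deg: "udeg p x \<Longrightarrow> p > 0 \<longrightarrow> part0 x = 0"
proof (induct rule: udeg.induct)
  case (zero p)
  then show ?case using part0_simps(1)[of 0] by (simp add: ualg_simps)
qed (auto simp: part0_simps)

lemma udeg_zeroD: "udeg p x \<Longrightarrow> p = 0 \<longrightarrow> x = ualg (part0 x)"
proof (induct rule: udeg.induct)
  case (zero p)
  then show ?case using part0_simps(1)[of 0] by (simp add: ualg_simps)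
qed (auto simp: part0_simps ualg_simps)

lemma rep_eq_zero: assumes "rep a = 0" shows "a = 0"
proof -
  have "rep a $ (1,1) $ (1,1) = 0" "rep a $ (1,2) $ (1,2) = 0" "rep a $ (2,2) $ (2,2) = 0"
    by (simp_all add: assms)
  then show ?thesis by (simp add: rep_def block_sum_def vec_eq_iff forall_3)
qed

lemma part0_Jid: assumes "x \<in> Jid" shows "part0 x = 0"
proof -
  have 1: "part0 x = 0" if "x \<in> J0" for x
    using that
  proof (induct rule: J0_induct)
    case (hom p x)
    show ?case
    proof (cases "p = 0")
      case True
      with hom have "x = ualg (part0 x)" using udeg_zeroD by (auto simp: J0_deg_def)
      moreover have "pi_u x = 0" using hom by (simp add: J0_deg_def)
      ultimately have "rep (part0 x) = 0" by (metis pi_u_simps(1))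
      then show ?thesis by (rule rep_eq_zero)
    next
      case False
      then show ?thesis using hom part0_deg by (auto simp: J0_deg_def)
    qed
  qed (simp add: part0_simps)
  have 2: "part0 (udiff x) = 0" for x
    by (induct x rule: univ_hom_induct) (use part0_deg udiff_deg in \<open>auto simp: udiff_simps part0_simps\<close>)
  show ?thesis using assms 1 2 unfolding Jid_def by (auto simp: part0_simps)
qed

quotient_type form = univ / "\<lambda>x y. x - y \<in> Jid"
proof (rule equivpI)
  show "reflp (\<lambda>x y. x - y \<in> Jid)" by (simp add: reflp_def Jid_zero)
  show "symp (\<lambda>x y. x - y \<in> Jid)" by (metis (mono_tags, lifting) Jid_neg minus_diff_eq sympI)
  show "transp (\<lambda>x y. x - y \<in> Jid)"
    by (rule transpI) (metis Jid_add diff_add_cancel diff_diff_eq2 add_diff_eq)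
qed

instantiation form :: ring_1
begin
lift_definition zero_form :: form is 0 .
lift_definition one_form :: form is 1 .
lift_definition plus_form :: "form \<Rightarrow> form \<Rightarrow> form" is "(+)"
proof -
  fix x x' y y' assume "x - x' \<in> Jid" "y - y' \<in> Jid"
  then show "x + y - (x' + y') \<in> Jid"
    using Jid_add by (metis add_diff_add)
qed
lift_definition uminus_form :: "form \<Rightarrow> form" is uminus
  using Jid_neg by fastforce
lift_definition minus_form :: "form \<Rightarrow> form \<Rightarrow> form" is "(-)"
proof -
  fix x x' y y' assume "x - x' \<in> Jid" "y - y' \<in> Jid"
  then have "(x - x') + - (y - y') \<in> Jid" using Jid_add Jid_neg by blast
  then show "x - y - (x' - y') \<in> Jid" by (simp add: algebra_simps)
qed
lift_definition times_form :: "form \<Rightarrow> form \<Rightarrow> form" is "(*)"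
proof -
  fix x x' y y' assume "x - x' \<in> Jid" "y - y' \<in> Jid"
  then have "(x - x') * y + x' * (y - y') \<in> Jid"
    by (intro Jid_add Jid_mult_left Jid_mult_right)
  then show "x * y - x' * y' \<in> Jid" by (simp add: algebra_simps)
qed
instance
proof
  show "(0::form) \<noteq> 1"
  proof (transfer, rule notI)
    assume "(0::univ) - 1 \<in> Jid"
    then have "part0 (- ualg 1) = 0" using part0_Jid by (fastforce simp: ualg_simps)
    then show False by (simp add: part0_simps)
  qed
qed (transfer, simp add: Jid_zero algebra_simps)+
end

text \<open>The product \<open>\<and>\<close> of Connes forms is the ring multiplication of \<^typ>\<open>form\<close>; \<open>conn\<close> is the
  projection from universal forms, and \<open>falg\<close> the inclusion of the algebra as the forms of degree
  zero, through which the bimodule structure is expressed.\<close>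

definition conn :: "univ \<Rightarrow> form" where
  "conn = abs_form"

lift_definition dform :: "form \<Rightarrow> form" is udiff
  using Jid_udiff by (metis udiff_minus)

definition falg :: "alg \<Rightarrow> form" where
  "falg a = conn (ualg a)"

definition Om :: "nat \<Rightarrow> form set" where
  "Om n = conn ` {w. udeg n w}"


lemma conn_simps: "conn (x + y) = conn x + conn y" "conn (- x) = - conn x" "conn (x - y) = conn x - conn y"
  "conn (x * y) = conn x * conn y" "conn 0 = 0" "conn 1 = 1" "dform (conn x) = conn (udiff x)"
  by (simp_all add: conn_def plus_form.abs_eq uminus_form.abs_eq minus_form.abs_eq times_form.abs_eq
      zero_form.abs_eq one_form.abs_eq dform.abs_eq)

lemma conn_eq_iff: "conn x = conn y \<longleftrightarrow> x - y \<in> Jid"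
  by (simp add: conn_def form.abs_eq_iff)

lemma conn_induct [case_names conn]: "(\<And>w. P (conn w)) \<Longrightarrow> P \<xi>"
  unfolding conn_def by (rule form.abs_induct)

lemma conn_sign: "conn ((-1) ^ k * x) = (-1) ^ k * conn x"
  by (cases "even k") (simp_all add: conn_simps)

subsection \<open>The involution\<close>

definition star_involution :: "(form \<Rightarrow> form) \<Rightarrow> bool" where
  "star_involution s \<longleftrightarrow>
     (\<forall>\<xi> \<eta>. s (\<xi> + \<eta>) = s \<xi> + s \<eta>) \<and>
     (\<forall>c \<xi>. s (falg (scal c) * \<xi>) = falg (scal (cnj c)) * s \<xi>) \<and>
     (\<forall>\<xi>. s (s \<xi>) = \<xi>) \<and>
     (\<forall>n. \<forall>\<xi>\<in>Om n. s \<xi> \<in> Om n) \<and>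
     (\<forall>a. s (falg a) = falg (alg_star a)) \<and>
     (\<forall>\<xi>. dform (s \<xi>) = s (dform \<xi>)) \<and>
     (\<forall>p q. \<forall>\<xi>\<in>Om p. \<forall>\<eta>\<in>Om q. s (\<xi> * \<eta>) = (-1) ^ (p * q) * (s \<eta> * s \<xi>))"

definition fstar :: "form \<Rightarrow> form" where
  "fstar = (THE s. star_involution s)"

text \<open>Existence and uniqueness of \<^const>\<open>fstar\<close> are established next. On universal forms we first
  construct the involution without signs, \<open>(x y)\<^sup>\<dagger> = y\<^sup>\<dagger> x\<^sup>\<dagger>\<close>.\<close>

lemma alg_star_simps: "alg_star (a + b) = alg_star a + alg_star b" "alg_star (a * b) = alg_star a * alg_star b"
  "alg_star 0 = 0" "alg_star 1 = 1" "alg_star (- a) = - alg_star a" "alg_star (alg_star a) = a"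
  "alg_star (scal c) = scal (cnj c)"
  by (simp_all add: alg_star_def scal_def vec_eq_iff)

definition star2 :: "alg2 \<Rightarrow> alg2" where
  "star2 = lift2 (\<lambda>a b. - pure2 (alg_star b) (alg_star a))"

lemma balanced2_star: "balanced2 (\<lambda>a b. - pure2 (alg_star b) (alg_star a))"
  by (simp add: balanced_def pure2_add alg_star_simps mult.commute[of "scal _"] pure2_balance)

lemmas star2_simps = lift2_simps[OF balanced2_star, folded star2_def]

lemma mult2_star2: "mult2 (star2 t) = - alg_star (mult2 t)"
  by (induct t rule: alg2_induct) (simp_all add: star2_simps mult2_simps alg_star_simps mult.commute)

lift_definition ustar1 :: "uform1 \<Rightarrow> uform1" is star2
  by (simp add: mult2_star2 alg_star_simps)

lemma star2_star2: "star2 (star2 t) = t"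
  by (induct t rule: alg2_induct) (simp_all add: star2_simps alg_star_simps)

lemma ustar1_simps: "ustar1 (m + n) = ustar1 m + ustar1 n" "ustar1 (ustar1 m) = m"
  "ustar1 (ulact a m) = uract (ustar1 m) (alg_star a)"
  "ustar1 (uract m a) = ulact (alg_star a) (ustar1 m)"
  "ustar1 (udiff0 a) = udiff0 (alg_star a)"
proof -
  have l: "star2 (lact2 a t) = ract2 (star2 t) (alg_star a)" for a t
    by (induct t rule: alg2_induct) (simp_all add: star2_simps lact2_simps ract2_simps alg_star_simps mult.commute)
  have r: "star2 (ract2 t a) = lact2 (alg_star a) (star2 t)" for a t
    by (induct t rule: alg2_induct) (simp_all add: star2_simps lact2_simps ract2_simps alg_star_simps mult.commute)
  show "ustar1 (m + n) = ustar1 m + ustar1 n" by transfer (simp add: star2_simps)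
  show "ustar1 (ustar1 m) = m" by transfer (simp add: star2_star2)
  show "ustar1 (ulact a m) = uract (ustar1 m) (alg_star a)" by transfer (simp add: l)
  show "ustar1 (uract m a) = ulact (alg_star a) (ustar1 m)" by transfer (simp add: r)
  show "ustar1 (udiff0 a) = udiff0 (alg_star a)"
    by transfer (simp add: star2_simps alg_star_simps diff_conv_add_uminus del: add_uminus_conv_diff)
qed

primrec seval :: "uterm \<Rightarrow> univ" where
  "seval (UAlg a) = ualg (alg_star a)"
| "seval (UForm m) = uform (ustar1 m)"
| "seval (UAdd x y) = seval x + seval y"
| "seval (UNeg x) = - seval x"
| "seval (UMul x y) = seval y * seval x"

lift_definition dagger :: "univ \<Rightarrow> univ" is seval
proof -
  fix x y assume "ucong x y"
  then show "seval x = seval y"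
  proof (induct rule: ucong.induct)
    case (alg_mul a b)
    then show ?case by (simp add: alg_star_simps ualg_simps mult.commute[of "alg_star a"])
  qed (simp_all add: alg_star_simps ustar1_simps ualg_simps uform_simps algebra_simps)
qed

lemma dagger_simps: "dagger (ualg a) = ualg (alg_star a)" "dagger (uform m) = uform (ustar1 m)"
  "dagger (x + y) = dagger x + dagger y" "dagger (- x) = - dagger x" "dagger (x * y) = dagger y * dagger x"
proof -
  show "dagger (ualg a) = ualg (alg_star a)" "dagger (uform m) = uform (ustar1 m)"
    by (simp_all add: dagger.abs_eq ualg.abs_eq uform.abs_eq)
  show "dagger (x + y) = dagger x + dagger y" "dagger (- x) = - dagger x" "dagger (x * y) = dagger y * dagger x"
    by (induct x rule: univ.abs_induct; induct y rule: univ.abs_induct;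
        simp add: dagger.abs_eq flip: abs_univ_simps(3-))+
qed

lemma dagger_dagger: "dagger (dagger x) = x"
  by (induct x rule: univ_induct) (simp_all add: dagger_simps alg_star_simps ustar1_simps)

lemma dagger_deg: "udeg p x \<Longrightarrow> udeg p (dagger x)"
proof (induct rule: udeg.induct)
  case (zero p)
  then show ?case using dagger_simps(1)[of 0] by (simp add: ualg_simps alg_star_simps udeg.zero)
next
  case (form m)
  then show ?case using udeg.form by (simp add: dagger_simps)
next
  case (mult p x q y)
  then show ?case using udeg.mult by (simp add: dagger_simps add.commute[of p])
qed (auto simp: dagger_simps intro: udeg.intros)

lemma dagger_grad: "dagger (grad x) = grad (dagger x)"
  by (induct x rule: univ_induct) (simp_all add: dagger_simps grad_simps)

lemma curv_ustar1: "dagger (curv m) = - curv (ustar1 m)"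
proof -
  have "dagger 0 = 0" using dagger_simps(1)[of 0] by (simp add: ualg_simps alg_star_simps)
  then have "dagger (lift2 (\<lambda>a b. dA a * dA b) t) = - lift2 (\<lambda>a b. dA a * dA b) (star2 t)" for t
    by (induct t rule: alg2_induct)
       (simp_all add: curv2_simps star2_simps dagger_simps ustar1_simps)
  then show ?thesis by (simp add: curv_def ustar1.rep_eq)
qed

lemma dagger_udiff: "dagger (udiff x) = udiff (grad (dagger x))"
  by (induct x rule: univ_induct)
     (simp_all add: udiff_simps dagger_simps grad_simps ustar1_simps curv_ustar1 dagger_grad grad_udiff
        grad_grad algebra_simps)

definition adj :: "oper \<Rightarrow> oper" where
  "adj M = (\<chi> i j. cnj (M $ j $ i))"

lemma adj_simps: "adj (M + N) = adj M + adj N" "adj (- M) = - adj M" "adj (M - N) = adj M - adj N"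
  "adj (M ** N) = adj N ** adj M" "adj 0 = 0"
  by (simp_all add: adj_def vec_eq_iff matrix_matrix_mult_def mult.commute)

lemma adj_rep: "adj (rep a) = rep (alg_star a)"
  by (auto simp: adj_def rep_def block_sum_def alg_star_def vec_eq_iff forall_2)

lemma adj_Dirac: "adj Dirac = Dirac"
  by (auto simp: adj_def Dirac_def block_sum_def vec_eq_iff forall_2)

lemma adj_comm_D: "adj (comm_D a) = - comm_D (alg_star a)"
  by (simp add: comm_D_def adj_simps adj_rep adj_Dirac)

lemma oper_of_form_ustar1: "oper_of_form (ustar1 m) = - adj (oper_of_form m)"
proof -
  let ?L = "lift2 (\<lambda>a b. rep a ** comm_D b)"
  have cm: "comm_D (- a) = - comm_D a" and c0: "comm_D 0 = 0" for a
    using comm_D_scal[of 0] by (simp_all add: comm_D_def rep_minus oper_distrib)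
  have "?L (star2 t) = - adj (?L t) - comm_D (alg_star (mult2 t))" for t
  proof (induct t rule: alg2_induct)
    case (pure a b)
    have "comm_D (alg_star (a * b)) = comm_D (alg_star b * alg_star a)"
      by (simp add: alg_star_simps mult.commute)
    then show ?case
      by (simp add: oper2_simps star2_simps mult2_simps adj_simps adj_rep adj_comm_D
          comm_D_mult oper_distrib)
  qed (simp_all add: oper2_simps star2_simps mult2_simps adj_simps alg_star_simps comm_D_add cm c0)
  then show ?thesis
    using Rep_uform1[of m] by (simp add: oper_of_form_def ustar1.rep_eq alg_star_simps c0)
qed

lemma pi_u_dagger: "pi_u (dagger x) = adj (pi_u (grad x))"
  by (induct x rule: univ_induct)
     (simp_all add: pi_u_simps dagger_simps grad_simps adj_simps adj_rep oper_of_form_ustar1)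


lemma uscal_central: "ualg (scal c) * w = w * ualg (scal c)"
proof (induct w rule: univ_induct)
  case (alg a)
  then show ?case by (simp add: mult.commute flip: ualg_simps)
next
  case (form m)
  have "lact2 (scal c) t = ract2 t (scal c)" for t
  proof (induct t rule: alg2_induct)
    case (pure a b)
    show ?case using pure2_balance[of a c b] by (simp add: lact2_simps ract2_simps mult.commute)
  qed (simp_all add: lact2_simps ract2_simps)
  then have "ulact (scal c) m = uract m (scal c)" by transfer
  then show ?case by (metis uform_simps(2,3))
next
  case (mult x y)
  then show ?case by (metis mult.assoc)
qed (simp_all add: ring_distribs)

text \<open>Multiplication by \<open>\<i>\<^sup>p\<close> in degree \<open>p\<close>.\<close>

primrec reval :: "uterm \<Rightarrow> univ" where
  "reval (UAlg a) = ualg a"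
| "reval (UForm m) = ualg (scal \<i>) * uform m"
| "reval (UAdd x y) = reval x + reval y"
| "reval (UNeg x) = - reval x"
| "reval (UMul x y) = reval x * reval y"

lift_definition rot :: "univ \<Rightarrow> univ" is reval
proof -
  fix x y assume "ucong x y"
  then show "reval x = reval y"
  proof (induct rule: ucong.induct)
    case (form_lact a m)
    then show ?case by (simp add: uform_simps uscal_central mult.assoc)
  qed (simp_all add: ualg_simps uform_simps algebra_simps)
qed

lemma rot_simps: "rot (ualg a) = ualg a" "rot (uform m) = ualg (scal \<i>) * uform m"
  "rot (x + y) = rot x + rot y" "rot (- x) = - rot x" "rot (x * y) = rot x * rot y"
proof -
  show "rot (ualg a) = ualg a" "rot (uform m) = ualg (scal \<i>) * uform m"
    by (simp_all add: rot.abs_eq ualg.abs_eq uform.abs_eq)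
  show "rot (x + y) = rot x + rot y" "rot (- x) = - rot x" "rot (x * y) = rot x * rot y"
    by (induct x rule: univ.abs_induct; induct y rule: univ.abs_induct;
        simp add: rot.abs_eq flip: abs_univ_simps(3-))+
qed

lemma rot_deg: "udeg p x \<Longrightarrow> rot x = ualg (scal (\<i> ^ p)) * x"
proof (induct rule: udeg.induct)
  case (zero p)
  then show ?case using rot_simps(1)[of 0] by (simp add: ualg_simps)
next
  case (mult p x q y)
  have "rot (x * y) = ualg (scal (\<i> ^ p)) * (x * ualg (scal (\<i> ^ q))) * y"
    using mult by (simp add: rot_simps mult.assoc)
  also have "\<dots> = ualg (scal (\<i> ^ p)) * ualg (scal (\<i> ^ q)) * (x * y)"
    by (simp only: uscal_central[where w = x, symmetric] mult.assoc)
  finally show ?case by (simp add: power_add ualg_simps)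
qed (simp_all add: rot_simps ualg_simps ring_distribs)

definition sgn2 :: "nat \<Rightarrow> complex" where
  "sgn2 p = (1 - \<i>) / 2 * \<i> ^ p + (1 + \<i>) / 2 * (- \<i>) ^ p"

lemma sgn2_simps: "sgn2 0 = 1" "sgn2 (Suc p) = (-1) ^ p * sgn2 p" "cnj (sgn2 p) = sgn2 p"
  "sgn2 (p + q) = (-1) ^ (p * q) * sgn2 p * sgn2 q" "sgn2 p * sgn2 p = 1"
proof -
  show 0: "sgn2 0 = 1" by (simp add: sgn2_def field_simps)
  have i: "\<i> ^ p = (-1) ^ p * (- \<i>) ^ p" for p
    by (simp flip: power_mult_distrib)
  show S: "sgn2 (Suc p) = (-1) ^ p * sgn2 p" for p
    unfolding sgn2_def i by (cases "even p") (simp_all add: field_simps)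
  show "cnj (sgn2 p) = sgn2 p" by (induct p) (simp_all add: 0 S)
  show "sgn2 (p + q) = (-1) ^ (p * q) * sgn2 p * sgn2 q"
    by (induct p) (simp_all add: 0 S power_add)
  show "sgn2 p * sgn2 p = 1"
    by (induct p) (simp_all add: 0 S power_mult_distrib[symmetric] mult_ac)
qed

definition ustar :: "univ \<Rightarrow> univ" where
  "ustar x = dagger (ualg (scal ((1 - \<i>) / 2)) * rot x + ualg (scal ((1 + \<i>) / 2)) * rot (grad x))"

lemma ustar_add: "ustar (x + y) = ustar x + ustar y"
  by (simp add: ustar_def rot_simps grad_simps dagger_simps algebra_simps)

lemma ustar_deg: assumes "udeg p x" shows "ustar x = ualg (scal (sgn2 p)) * dagger x"
proof -
  have s: "rot ((-1) ^ p * x) = ualg (scal ((-1) ^ p)) * rot x"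
    by (cases "even p") (simp_all add: rot_simps ualg_simps ualg_minus)
  have "ualg (scal ((1 - \<i>) / 2)) * rot x + ualg (scal ((1 + \<i>) / 2)) * rot (grad x)
      = ualg (scal ((1 - \<i>) / 2) * scal (\<i> ^ p) + scal ((1 + \<i>) / 2) * scal ((-1) ^ p) * scal (\<i> ^ p)) * x"
    by (simp only: grad_deg[OF assms] s rot_deg[OF assms] ualg_simps ring_distribs mult.assoc)
  also have "scal ((1 - \<i>) / 2) * scal (\<i> ^ p) + scal ((1 + \<i>) / 2) * scal ((-1) ^ p) * scal (\<i> ^ p)
      = scal (sgn2 p)"
    by (simp add: sgn2_def power_minus[of \<i>] mult.assoc flip: scal_simps)
  finally have "ustar x = dagger (ualg (scal (sgn2 p)) * x)" by (simp add: ustar_def)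
  then show ?thesis by (simp add: dagger_simps alg_star_simps sgn2_simps uscal_central)
qed

lemma udeg_scal: "udeg p x \<Longrightarrow> udeg p (ualg (scal c) * x)"
  using udeg.mult[OF udeg.alg[of "scal c"], of p x] by simp

lemma ustar_preserves_deg: "udeg p x \<Longrightarrow> udeg p (ustar x)"
  by (simp add: ustar_deg udeg_scal dagger_deg)

lemma ustar_ualg: "ustar (ualg a) = ualg (alg_star a)"
  using ustar_deg[OF udeg.alg[of a]] by (simp add: sgn2_simps ualg_simps dagger_simps)

lemma ustar_scal: "ustar (ualg (scal c) * x) = ualg (scal (cnj c)) * ustar x"
proof (induct x rule: univ_hom_induct)
  case (hom p x)
  have "ustar (ualg (scal c) * x) = ualg (scal (sgn2 p)) * (dagger x * ualg (scal (cnj c)))"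
    using hom by (simp add: ustar_deg[OF udeg_scal] dagger_simps alg_star_simps)
  also have "\<dots> = ualg (scal (cnj c)) * (ualg (scal (sgn2 p)) * dagger x)"
    by (simp only: uscal_central[of "cnj c"] mult.assoc)
  finally show ?case using hom by (simp add: ustar_deg)
qed (simp add: ring_distribs ustar_add)

lemma ustar_ustar: "ustar (ustar x) = x"
proof (induct x rule: univ_hom_induct)
  case (hom p x)
  have "ualg (scal (sgn2 p)) * (ualg (scal (sgn2 p)) * x) = ualg (scal (sgn2 p * sgn2 p)) * x"
    by (simp only: scal_simps ualg_simps mult.assoc)
  then have "ualg (scal (sgn2 p)) * (ualg (scal (sgn2 p)) * x) = x"
    by (simp add: sgn2_simps ualg_simps del: scal_simps(5))
  then show ?case using hom
    by (simp add: ustar_deg[OF hom] ustar_scal ustar_deg[OF dagger_deg[OF hom]] dagger_dagger sgn2_simps(3))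
qed (simp add: ustar_add)

lemma uscal_sign: "ualg (scal ((-1) ^ k)) = (-1) ^ k"
  by (cases "even k") (simp_all add: ualg_simps ualg_minus)

lemma ustar_udiff: "ustar (udiff x) = udiff (ustar x)"
proof (induct x rule: univ_hom_induct)
  case (hom p x)
  have d: "udiff (ualg (scal c) * w) = ualg (scal c) * udiff w" for c w
    by (simp add: udiff_simps grad_simps dA_scal)
  have "ustar (udiff x) = ualg (scal (sgn2 (Suc p))) * udiff (grad (dagger x))"
    using hom by (simp add: ustar_deg[OF udiff_deg] dagger_udiff)
  also have "grad (dagger x) = ualg (scal ((-1) ^ p)) * dagger x"
    using hom by (simp add: grad_deg dagger_deg uscal_sign)
  also have "ualg (scal (sgn2 (Suc p))) * udiff (ualg (scal ((-1) ^ p)) * dagger x)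
     = ualg (scal (sgn2 (Suc p) * (-1) ^ p)) * udiff (dagger x)"
    by (simp only: d scal_simps ualg_simps mult.assoc)
  also have "sgn2 (Suc p) * (-1) ^ p = sgn2 p"
    by (cases "even p") (simp_all add: sgn2_simps)
  finally show ?case using hom by (simp add: ustar_deg d)
qed (simp add: ustar_add udiff_simps)

lemma ustar_mult:
  assumes "udeg p x" "udeg q y"
  shows "ustar (x * y) = (-1) ^ (p * q) * (ustar y * ustar x)"
proof -
  have "ustar (x * y) = ualg (scal ((-1) ^ (p * q))) * (ualg (scal (sgn2 p)) * ualg (scal (sgn2 q)) * dagger y) * dagger x"
    using assms by (simp add: ustar_deg[OF udeg.mult] sgn2_simps dagger_simps ualg_simps mult.assoc)
  also have "\<dots> = (-1) ^ (p * q) * ((ualg (scal (sgn2 q)) * dagger y) * (ualg (scal (sgn2 p)) * dagger x))"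
    by (simp only: uscal_central[of "sgn2 p"] uscal_sign mult.assoc)
  finally show ?thesis using assms by (simp add: ustar_deg)
qed

lemma J0_ustar: "x \<in> J0 \<Longrightarrow> ustar x \<in> J0"
proof (induct rule: J0_induct)
  case (hom p x)
  then have "grad x = (-1) ^ p * x" "pi_u x = 0" by (simp_all add: J0_deg_def grad_deg)
  then have "pi_u (dagger x) = 0"
    by (cases "even p") (simp_all add: pi_u_dagger pi_u_simps adj_simps)
  then have "ustar x \<in> J0_deg p"
    using hom ustar_preserves_deg[of p x] ustar_deg[of p x]
    by (auto simp: J0_deg_def pi_u_simps oper_distrib)
  then show ?case by (rule J0_hom)
qed (simp add: J0_add ustar_add)

lemma Jid_ustar: "x \<in> Jid \<Longrightarrow> ustar x \<in> Jid"
  unfolding Jid_def by (auto simp: ustar_add ustar_udiff) (use J0_ustar in blast)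

lemma ustar_minus: "ustar (- x) = - ustar x"
  using ustar_scal[of "- 1" x] by (simp add: ualg_minus ualg_simps)

lift_definition fstar' :: "form \<Rightarrow> form" is ustar
proof -
  fix x y assume "x - y \<in> Jid"
  then have "ustar (x - y) \<in> Jid" by (rule Jid_ustar)
  moreover have "ustar (x - y) = ustar x - ustar y"
    using ustar_add[of x "- y"] by (simp add: ustar_minus)
  ultimately show "ustar x - ustar y \<in> Jid" by simp
qed

lemma fstar'_conn: "fstar' (conn x) = conn (ustar x)"
  by (simp add: conn_def fstar'.abs_eq)

lemma star_involution_fstar': "star_involution fstar'"
  unfolding star_involution_def
proof (intro conjI allI ballI)
  fix \<xi> \<eta> show "fstar' (\<xi> + \<eta>) = fstar' \<xi> + fstar' \<eta>"
    by (induct \<xi> rule: conn_induct; induct \<eta> rule: conn_induct)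
       (simp add: fstar'_conn ustar_add flip: conn_simps)
next
  fix c \<xi> show "fstar' (falg (scal c) * \<xi>) = falg (scal (cnj c)) * fstar' \<xi>"
    by (induct \<xi> rule: conn_induct) (simp add: falg_def fstar'_conn ustar_scal flip: conn_simps(4))
next
  fix \<xi> show "fstar' (fstar' \<xi>) = \<xi>"
    by (induct \<xi> rule: conn_induct) (simp add: fstar'_conn ustar_ustar)
next
  fix n \<xi> assume "\<xi> \<in> Om n" then show "fstar' \<xi> \<in> Om n"
    by (auto simp: Om_def fstar'_conn ustar_preserves_deg)
next
  fix a show "fstar' (falg a) = falg (alg_star a)"
    by (simp add: falg_def fstar'_conn ustar_ualg)
next
  fix \<xi> show "dform (fstar' \<xi>) = fstar' (dform \<xi>)"
    by (induct \<xi> rule: conn_induct) (simp add: fstar'_conn ustar_udiff conn_simps(7))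
next
  fix p q \<xi> \<eta> assume "\<xi> \<in> Om p" "\<eta> \<in> Om q"
  then show "fstar' (\<xi> * \<eta>) = (-1) ^ (p * q) * (fstar' \<eta> * fstar' \<xi>)"
    by (auto simp: Om_def fstar'_conn ustar_mult conn_sign simp flip: conn_simps(4))
qed

lemma star_involution_unique:
  assumes "star_involution s" "star_involution s'"
  shows "s = s'"
proof -
  have add: "t (\<xi> + \<eta>) = t \<xi> + t \<eta>" and alg: "t (falg a) = falg (alg_star a)"
    and dd: "t (dform \<xi>) = dform (t \<xi>)"
    and mul: "\<xi> \<in> Om p \<Longrightarrow> \<eta> \<in> Om q \<Longrightarrow> t (\<xi> * \<eta>) = (-1) ^ (p * q) * (t \<eta> * t \<xi>)"
    if "star_involution t" for t \<xi> \<eta> a p q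
    using that unfolding star_involution_def by (blast, blast, simp, blast)
  have zero: "t 0 = 0" if "star_involution t" for t
    using add[OF that, of 0 0] by simp
  have neg: "t (- \<xi>) = - t \<xi>" if "star_involution t" for t \<xi>
    using add[OF that, of \<xi> "- \<xi>"] by (simp add: zero[OF that] eq_neg_iff_add_eq_0 add.commute)
  note * = assms[THEN add] assms[THEN alg] assms[THEN zero] assms[THEN neg]
  have d: "s (conn (dA a)) = s' (conn (dA a))" for a
  proof -
    have "conn (dA a) = dform (falg a)" by (simp only: falg_def conn_simps udiff_simps)
    then show ?thesis by (simp only: assms[THEN dd] *)
  qed
  have "s (conn (uform m)) = s' (conn (uform m))" for m
  proof -
    have "s (conn (lift2 (\<lambda>a b. ualg a * dA b) t)) = s' (conn (lift2 (\<lambda>a b. ualg a * dA b) t))" for t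
    proof (induct t rule: alg2_induct)
      case (pure a b)
      have "conn (ualg a) \<in> Om 0" "conn (dA b) \<in> Om 1"
        unfolding Om_def using udeg.alg udeg.form by blast+
      then have "t (conn (ualg a) * conn (dA b)) = t (conn (dA b)) * t (conn (ualg a))"
        if "star_involution t" for t using mul[OF that, of "conn (ualg a)" 0 "conn (dA b)" 1] by simp
      from this[OF assms(1)] this[OF assms(2)] show ?case
        using d[of b] *(3,4)[of a] by (simp only: form2_simps conn_simps(4) falg_def)
    qed (simp_all only: form2_simps conn_simps *)
    then show ?thesis by (simp only: uform_eq_lift2[of m])
  qed
  note uf = this
  have "s (conn x) = s' (conn x)" for x
  proof (induct x rule: univ_hom_induct)
    case (hom p x)
    then show ?case
    proof (induct rule: udeg.induct)
      case (mult p x q y)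
      then have "conn x \<in> Om p" "conn y \<in> Om q" by (auto simp: Om_def)
      then have "t (conn (x * y)) = (-1) ^ (p * q) * (t (conn y) * t (conn x))"
        if "star_involution t" for t using mul[OF that] by (simp add: conn_simps(4))
      from this[OF assms(1)] this[OF assms(2)] show ?case
        using mult by (simp only:)
    next
      case (alg a)
      show ?case using *(3,4)[of a] by (simp only: falg_def)
    next
      case (form m)
      show ?case by (rule uf)
    next
      case (add p x y)
      then show ?case by (simp only: conn_simps(1) *)
    next
      case (zero p)
      show ?case by (simp only: conn_simps(5) *)
    qed
  next
    case (add x y)
    then show ?case by (simp only: conn_simps(1) *)
  qed
  then have "s \<xi> = s' \<xi>" for \<xi> by (induct \<xi> rule: conn_induct)
  then show ?thesis by blast
qed

lemma star_involution_fstar: "star_involution fstar"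
  unfolding fstar_def
  by (rule theI[of star_involution, OF star_involution_fstar'])
     (rule star_involution_unique[OF _ star_involution_fstar'])


lemma Om_add: "\<xi> \<in> Om n \<Longrightarrow> \<eta> \<in> Om n \<Longrightarrow> \<xi> + \<eta> \<in> Om n"
  by (auto simp: Om_def simp flip: conn_simps(1) intro!: udeg.add)

lemma Om_zero: "0 \<in> Om n"
  unfolding Om_def using udeg.zero conn_simps(5) by (metis image_eqI mem_Collect_eq)

lemma Om_neg: "\<xi> \<in> Om n \<Longrightarrow> - \<xi> \<in> Om n"
  by (auto simp: Om_def simp flip: conn_simps(2) intro!: udeg_neg)

lemma Om_mult: "\<xi> \<in> Om p \<Longrightarrow> \<eta> \<in> Om q \<Longrightarrow> \<xi> * \<eta> \<in> Om (p + q)"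
  by (auto simp: Om_def simp flip: conn_simps(4) intro!: udeg.mult)

lemma falg_Om: "falg a \<in> Om 0"
  by (auto simp: Om_def falg_def intro: udeg.alg)

lemma falg_simps: "falg (a + b) = falg a + falg b" "falg (a * b) = falg a * falg b"
  "falg 0 = 0" "falg 1 = 1" "falg (- a) = - falg a"
  by (simp_all add: falg_def ualg_simps ualg_minus conn_simps)

section \<open>The bimodule of 1-forms and its tensor square\<close>

typedef form1 = "Om 1"
  using Om_zero by blast

setup_lifting type_definition_form1

instantiation form1 :: ab_group_add
begin
lift_definition zero_form1 :: form1 is 0 by (rule Om_zero)
lift_definition plus_form1 :: "form1 \<Rightarrow> form1 \<Rightarrow> form1" is "(+)" by (rule Om_add)
lift_definition uminus_form1 :: "form1 \<Rightarrow> form1" is uminus by (rule Om_neg)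
lift_definition minus_form1 :: "form1 \<Rightarrow> form1 \<Rightarrow> form1" is "(-)"
  by (metis Om_add Om_neg diff_conv_add_uminus)
instance by standard (transfer, simp)+
end

lift_definition flact :: "alg \<Rightarrow> form1 \<Rightarrow> form1" is "\<lambda>a \<xi>. falg a * \<xi>"
  using Om_mult[OF falg_Om] by fastforce

lift_definition fract :: "form1 \<Rightarrow> alg \<Rightarrow> form1" is "\<lambda>\<xi> a. \<xi> * falg a"
  using Om_mult[OF _ falg_Om] by fastforce

quotient_type form11 = "(form1, form1) tterm" / "tcong fract flact"
  by (rule equivp_tcong)

instantiation form11 :: ab_group_add
begin
lift_definition zero_form11 :: form11 is TZero .
lift_definition plus_form11 :: "form11 \<Rightarrow> form11 \<Rightarrow> form11" is TAdd by (rule tcong.add_cong)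
lift_definition uminus_form11 :: "form11 \<Rightarrow> form11" is TNeg by (rule tcong.neg_cong)
definition minus_form11 :: "form11 \<Rightarrow> form11 \<Rightarrow> form11" where "minus_form11 x y = x + - y"
instance
  by standard
     (transfer, intro tcong.add_assoc tcong.add_comm tcong.add_zero tcong.add_neg
       | simp add: minus_form11_def)+
end

definition pure11 :: "form1 \<Rightarrow> form1 \<Rightarrow> form11" where
  "pure11 \<xi> \<eta> = abs_form11 (TPure \<xi> \<eta>)"

text \<open>The additive map on the tensor square induced by a balanced map \<open>\<beta>\<close>.\<close>

definition lift11 :: "(form1 \<Rightarrow> form1 \<Rightarrow> 'b::ab_group_add) \<Rightarrow> form11 \<Rightarrow> 'b" where
  "lift11 \<beta> t = teval \<beta> (rep_form11 t)"

lemma form11_induct [case_names zero pure add neg]: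
  assumes "P 0" "\<And>\<xi> \<eta>. P (pure11 \<xi> \<eta>)" "\<And>x y. P x \<Longrightarrow> P y \<Longrightarrow> P (x + y)" "\<And>x. P x \<Longrightarrow> P (- x)"
  shows "P t"
proof -
  have "P (abs_form11 x)" for x
    by (induction x)
       (use assms in \<open>auto simp: zero_form11_def pure11_def plus_form11.abs_eq[symmetric] uminus_form11.abs_eq[symmetric]\<close>)
  then show ?thesis by (induct t rule: form11.abs_induct)
qed

context
  fixes \<beta> :: "form1 \<Rightarrow> form1 \<Rightarrow> 'b::ab_group_add"
  assumes bal: "balanced fract flact \<beta>"
begin
lemma lift11_abs: "lift11 \<beta> (abs_form11 x) = teval \<beta> x"
  unfolding lift11_def
  by (rule teval_cong[OF _ bal]) (simp add: Quotient3_rep_abs[OF Quotient3_form11] tcong.refl)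
lemma lift11_zero: "lift11 \<beta> 0 = 0"
  by (simp add: zero_form11_def lift11_abs)
lemma lift11_pure: "lift11 \<beta> (pure11 \<xi> \<eta>) = \<beta> \<xi> \<eta>"
  by (simp add: pure11_def lift11_abs)
lemma lift11_add: "lift11 \<beta> (x + y) = lift11 \<beta> x + lift11 \<beta> y"
  by (induct x rule: form11.abs_induct; induct y rule: form11.abs_induct) (simp add: plus_form11.abs_eq lift11_abs)
lemma lift11_neg: "lift11 \<beta> (- x) = - lift11 \<beta> x"
  by (induct x rule: form11.abs_induct) (simp add: uminus_form11.abs_eq lift11_abs)
end

lemma pure11_simps: "pure11 (\<xi> + \<xi>') \<eta> = pure11 \<xi> \<eta> + pure11 \<xi>' \<eta>"
  "pure11 \<xi> (\<eta> + \<eta>') = pure11 \<xi> \<eta> + pure11 \<xi> \<eta>'"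
  "pure11 (fract \<xi> a) \<eta> = pure11 \<xi> (flact a \<eta>)"
  by (simp_all add: pure11_def plus_form11.abs_eq form11.abs_eq_iff tcong.left_add tcong.right_add
      tcong.balance)

definition lact11 :: "alg \<Rightarrow> form11 \<Rightarrow> form11" where
  "lact11 a = lift11 (\<lambda>\<xi> \<eta>. pure11 (flact a \<xi>) \<eta>)"

definition ract11 :: "form11 \<Rightarrow> alg \<Rightarrow> form11" where
  "ract11 t a = lift11 (\<lambda>\<xi> \<eta>. pure11 \<xi> (fract \<eta> a)) t"

definition map11 :: "(form1 \<Rightarrow> form1) \<Rightarrow> (form1 \<Rightarrow> form1) \<Rightarrow> form11 \<Rightarrow> form11" where
  "map11 F G = lift11 (\<lambda>\<xi> \<eta>. pure11 (F \<xi>) (G \<eta>))"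

definition wedge11 :: "form11 \<Rightarrow> form" where
  "wedge11 = lift11 (\<lambda>\<xi> \<eta>. Rep_form1 \<xi> * Rep_form1 \<eta>)"

text \<open>The restriction to 1-forms of a map that preserves them.\<close>

definition on1 :: "(form \<Rightarrow> form) \<Rightarrow> form1 \<Rightarrow> form1" where
  "on1 F \<xi> = Abs_form1 (F (Rep_form1 \<xi>))"

section \<open>Complex structures\<close>

definition almost_complex :: "(form \<Rightarrow> form) \<Rightarrow> bool" where
  "almost_complex J \<longleftrightarrow>
     (\<forall>\<xi> \<eta>. J (\<xi> + \<eta>) = J \<xi> + J \<eta>) \<and>
     (\<forall>c \<xi>. J (falg (scal c) * \<xi>) = falg (scal c) * J \<xi>) \<and>
     (\<forall>n. \<forall>\<xi>\<in>Om n. J \<xi> \<in> Om n) \<and>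
     (\<forall>\<xi> \<eta>. J (\<xi> * \<eta>) = J \<xi> * \<eta> + \<xi> * J \<eta>) \<and>
     (\<forall>a. J (falg a) = 0) \<and>
     (\<forall>\<xi>\<in>Om 1. J (J \<xi>) = - \<xi>) \<and>
     (\<forall>\<xi>\<in>Om 1. J (fstar \<xi>) = fstar (J \<xi>))"

definition Om_pq :: "(form \<Rightarrow> form) \<Rightarrow> nat \<Rightarrow> nat \<Rightarrow> form set" where
  "Om_pq J p q = {\<xi> \<in> Om (p + q). J \<xi> = falg (scal ((of_nat p - of_nat q) * \<i>)) * \<xi>}"

text \<open>The \<open>(p, q)\<close> component in the decomposition of the forms of degree \<open>p + q\<close>; \<open>f r\<close> is the
  component of type \<open>(r, p + q - r)\<close>.\<close>

definition proj_pq :: "(form \<Rightarrow> form) \<Rightarrow> nat \<Rightarrow> nat \<Rightarrow> form \<Rightarrow> form" where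
  "proj_pq J p q \<xi> = (THE \<alpha>. \<exists>f. (\<forall>r\<le>p + q. f r \<in> Om_pq J r (p + q - r)) \<and>
     \<xi> = (\<Sum>r\<le>p + q. f r) \<and> \<alpha> = f p)"

definition integrable_acs :: "(form \<Rightarrow> form) \<Rightarrow> bool" where
  "integrable_acs J \<longleftrightarrow>
     (\<forall>\<xi>\<in>Om_pq J 1 0. \<exists>\<alpha>\<in>Om_pq J 2 0. \<exists>\<beta>\<in>Om_pq J 1 1. dform \<xi> = \<alpha> + \<beta>)"

definition complex_structure :: "(form \<Rightarrow> form) \<Rightarrow> bool" where
  "complex_structure J \<longleftrightarrow> almost_complex J \<and> integrable_acs J"

text \<open>The class of the universal form \<open>d \<chi>\<^sub>k\<close>; under \<^const>\<open>pi_u\<close> it is \<open>[D, \<chi>\<^sub>k]\<close>.\<close>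

definition e_form :: "3 \<Rightarrow> form" where
  "e_form k = dform (falg (chi k))"

definition scale_mat :: "complex \<Rightarrow> alg^2^2 \<Rightarrow> alg^2^2" where
  "scale_mat c M = (\<chi> k i. scal c * M $ k $ i)"

definition J_matrices :: "(alg^2^2) set" where
  "J_matrices = {scale_mat c M | c M. c \<in> {\<i>, - \<i>} \<and> M \<in>
     {vector [vector [1 - 2 * chi 3, 0],
              vector [2 * chi 1, 2 * chi 2 - 1]],
      vector [vector [1 - 2 * chi 3, - 2 * chi 2],
              vector [2 * chi 1, 2 * chi 3 - 1]],
      vector [vector [2 * chi 1 - 1, 2 * chi 2],
              vector [0, 1 - 2 * chi 3]],
      vector [vector [2 * chi 1 - 1, 0],
              vector [0, 1 - 2 * chi 2]]}}"

section \<open>Metrics\<close>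

definition right_dual :: "(form1 \<Rightarrow> alg) set" where
  "right_dual = {\<phi>. (\<forall>\<xi> \<eta>. \<phi> (\<xi> + \<eta>) = \<phi> \<xi> + \<phi> \<eta>) \<and> (\<forall>\<xi> a. \<phi> (fract \<xi> a) = \<phi> \<xi> * a)}"

text \<open>Right linearity of \<open>\<xi> \<mapsto> g(\<xi>, \<cdot>)\<close>, for the right action \<open>(\<phi> a)(\<eta>) = \<phi>(a \<eta>)\<close> on the
  dual, is automatic because \<open>g\<close> is defined on the tensor product; nondegeneracy is therefore
  bijectivity.\<close>

definition is_metric :: "(form11 \<Rightarrow> alg) \<Rightarrow> bool" where
  "is_metric g \<longleftrightarrow>
     (\<forall>s t. g (s + t) = g s + g t) \<and>
     (\<forall>a t. g (lact11 a t) = a * g t) \<and>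
     (\<forall>a t. g (ract11 t a) = g t * a) \<and>
     bij_betw (\<lambda>\<xi> \<eta>. g (pure11 \<xi> \<eta>)) UNIV right_dual"

definition compatible :: "(form11 \<Rightarrow> alg) \<Rightarrow> (form \<Rightarrow> form) \<Rightarrow> bool" where
  "compatible g J \<longleftrightarrow> (\<forall>t. g (map11 (on1 J) (on1 J) t) = g t)"

text \<open>\<open>(g \<otimes> id)(\<xi> \<otimes> t)\<close> and \<open>(id \<otimes> g)(t \<otimes> \<xi>)\<close>, after identifying \<open>A \<otimes>\<^sub>A \<Omega>\<^sup>1\<close> and \<open>\<Omega>\<^sup>1 \<otimes>\<^sub>A A\<close>
  with \<open>\<Omega>\<^sup>1\<close>.\<close>

definition contract_left :: "(form11 \<Rightarrow> alg) \<Rightarrow> form1 \<Rightarrow> form11 \<Rightarrow> form1" where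
  "contract_left g \<xi> = lift11 (\<lambda>\<eta> \<zeta>. flact (g (pure11 \<xi> \<eta>)) \<zeta>)"

definition contract_right :: "(form11 \<Rightarrow> alg) \<Rightarrow> form11 \<Rightarrow> form1 \<Rightarrow> form1" where
  "contract_right g t \<xi> = lift11 (\<lambda>\<eta> \<zeta>. fract \<eta> (g (pure11 \<zeta> \<xi>))) t"

text \<open>The element \<open>t\<close> singled out here is the image of 1 under the inverse of the metric.\<close>

definition metric_inverse :: "(form11 \<Rightarrow> alg) \<Rightarrow> form11" where
  "metric_inverse g = (THE t. \<forall>\<xi>. contract_left g \<xi> t = \<xi> \<and> contract_right g t \<xi> = \<xi>)"

definition fundamental_form :: "(form \<Rightarrow> form) \<Rightarrow> (form11 \<Rightarrow> alg) \<Rightarrow> form" where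
  "fundamental_form J g = wedge11 (map11 (on1 J) id
     (map11 (on1 (proj_pq J 1 0)) (on1 (proj_pq J 0 1)) (metric_inverse g)))"

definition is_kaehler :: "(form11 \<Rightarrow> alg) \<Rightarrow> (form \<Rightarrow> form) \<Rightarrow> bool" where
  "is_kaehler g J \<longleftrightarrow> dform (fundamental_form J g) = 0"

end

(* Since D^2 = 1, the differential of a Connes form acts on H as the graded commutator with D, so
   representing forms as operators is compatible with d. As a bimodule, Omega^1 splits into the lines
   spanned by E_ij = chi_i e_j (i and j distinct), which are distinguished by their endpoints. Hence a
   metric is given by nonzero numbers g_ij with g(E_ij, E_ji) = g_ij chi_i, its inverse is the sum of
   E_ji (x) E_ij / g_ij, and J E_ij = c_ij E_ij with c_ij = i or -i and, because J commutes with the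
   involution, c_ji = -c_ij. The fundamental form is therefore a combination of the E_ji E_ij in which
   exactly one of E_ij E_ji and E_ji E_ij occurs for every pair i, j. On the block labelled ij it is a
   diagonal matrix with exactly one nonzero entry, which does not commute with D. *)

theory Submission
  imports Defs
begin

section \<open>Connes forms as operators\<close>

lemma Dirac_square: "Dirac ** Dirac = mat 1"
  unfolding Dirac_def block_sum_mult
  by (auto simp: block_sum_def mat_def vec_eq_iff forall_2 prod_eq_iff matrix_matrix_mult_def sum_2)

text \<open>Both sides obey the same graded Leibniz rule in \<open>x\<close>, so the generators
  decide. For \<open>a db\<close> the claim reads \<open>[D,a][D,b] = D a[D,b] + a[D,b] D\<close>,
  which holds because \<open>D\<close> squares to 1.\<close>

lemma pi_u_udiff: "pi_u (udiff x) = Dirac ** pi_u x - pi_u (grad x) ** Dirac"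
proof (induct x rule: univ_induct)
  case (alg a)
  show ?case by (simp add: udiff_simps grad_simps pi_u_dA pi_u_simps(1) comm_D_def)
next
  case (form m)
  let ?L = "lift2 (\<lambda>a b. rep a ** comm_D b)"
  have "pi_u (lift2 (\<lambda>a b. dA a * dA b) t) = Dirac ** ?L t + ?L t ** Dirac" for t
  proof (induct t rule: alg2_induct)
    case (pure a b)
    have sq: "M ** Dirac ** Dirac = M" for M
      by (simp add: Dirac_square flip: matrix_mul_assoc)
    have "pi_u (lift2 (\<lambda>a b. dA a * dA b) (pure2 a b)) = comm_D a ** comm_D b"
      by (simp only: curv2_simps pi_u_simps(5) pi_u_dA)
    also have "\<dots> = Dirac ** (rep a ** comm_D b) + (rep a ** comm_D b) ** Dirac"
      by (simp add: comm_D_def oper_distrib matrix_mul_assoc sq)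
    finally show ?case by (simp only: oper2_simps)
  qed (simp_all add: curv2_simps oper2_simps pi_u_simps pi_u_zero oper_distrib)
  then show ?case
    by (simp add: udiff_simps grad_simps pi_u_simps curv_def oper_of_form_def oper_distrib)
qed (simp_all add: udiff_simps grad_simps pi_u_simps oper_distrib matrix_mul_assoc)

lemma pi_u_J0: "x \<in> J0 \<Longrightarrow> pi_u x = 0"
  by (induct rule: J0_induct) (simp_all add: J0_deg_def pi_u_simps)

text \<open>Since \<open>D\<^sup>2 = 1\<close>, the differential is a graded commutator with \<open>D\<close> and adds nothing to the
  junk: \<^const>\<open>pi_u\<close> descends to Connes forms.\<close>

lemma pi_u_Jid: "x \<in> Jid \<Longrightarrow> pi_u x = 0"
  by (auto simp: Jid_def pi_u_simps pi_u_udiff pi_u_J0 J0_grad oper_distrib)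

lift_definition form_oper :: "form \<Rightarrow> oper" is pi_u
proof -
  fix x y assume "x - y \<in> Jid"
  then have "pi_u (x + - y) = 0" by (simp add: pi_u_Jid)
  then show "pi_u x = pi_u y" unfolding pi_u_simps by simp
qed

lemma form_oper_conn: "form_oper (conn x) = pi_u x"
  by (simp add: conn_def form_oper.abs_eq)

lemma form_oper_add: "form_oper (\<xi> + \<eta>) = form_oper \<xi> + form_oper \<eta>"
  by transfer (rule pi_u_simps)

lemma form_oper_mult: "form_oper (\<xi> * \<eta>) = form_oper \<xi> ** form_oper \<eta>"
  by transfer (rule pi_u_simps)

lemma form_oper_zero: "form_oper 0 = 0"
  by transfer (rule pi_u_zero)

lemma form_oper_falg: "form_oper (falg a) = rep a"
  by (simp add: falg_def form_oper_conn pi_u_simps)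

lemma form_oper_sum: "form_oper (\<Sum>i\<in>I. f i) = (\<Sum>i\<in>I. form_oper (f i))"
  by (induct I rule: infinite_finite_induct) (simp_all add: form_oper_zero form_oper_add)

text \<open>The sign is the grading automorphism in degree \<open>n\<close>. It drops out for the
  2-forms to which this is applied, leaving an ordinary commutator.\<close>

lemma form_oper_dform:
  "\<xi> \<in> Om n \<Longrightarrow> form_oper (dform \<xi>) = Dirac ** form_oper \<xi> - form_oper ((-1) ^ n * \<xi>) ** Dirac"
  by (auto simp: Om_def conn_simps(7) form_oper_conn pi_u_udiff grad_deg simp flip: conn_sign)

lemma dform_falg: "dform (falg a) = conn (dA a)"
  by (simp add: falg_def conn_simps udiff_simps)

lemma form_oper_e_form: "form_oper (e_form k) = comm_D (chi k)"
  by (simp add: e_form_def dform_falg form_oper_conn pi_u_dA)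

lemma e_form_Om: "e_form k \<in> Om 1"
  unfolding e_form_def dform_falg Om_def using udeg.form by blast

lemma falg_scal_commute: "falg (scal c) * \<xi> = \<xi> * falg (scal c)"
  by (induct \<xi> rule: conn_induct) (simp add: falg_def uscal_central flip: conn_simps(4))

section \<open>Arrow decomposition of 1-forms\<close>

lemma chi_mult: "chi i * chi j = (if i = j then chi i else 0)"
  by (auto simp: chi_def vec_eq_iff)

lemma sum_chi: "(\<Sum>i\<in>UNIV. chi i) = 1"
  by (simp add: vec_eq_iff chi_def)

lemma mult_chi: "a * chi i = scal (a $ i) * chi i"
  by (simp add: chi_def scal_def vec_eq_iff)

lemma alg_eq_sum_chi: "a = (\<Sum>k\<in>UNIV. scal (a $ k) * chi k)"
  by (simp add: chi_def scal_def vec_eq_iff if_distrib cong: if_cong)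

text \<open>For \<open>i \<noteq> j\<close> the last factor changes nothing; its purpose is to make the form vanish for \<open>i = j\<close>,
  so that sums over arrows can range over all pairs of points.\<close>

lift_definition arrow :: "3 \<Rightarrow> 3 \<Rightarrow> form1" is "\<lambda>i j. falg (chi i) * e_form j * falg (chi j)"
  using Om_mult[OF Om_mult[OF falg_Om e_form_Om] falg_Om] by simp

lemma flact_simps: "flact a (\<xi> + \<eta>) = flact a \<xi> + flact a \<eta>" "flact (a + b) \<xi> = flact a \<xi> + flact b \<xi>"
  "flact a (flact b \<xi>) = flact (a * b) \<xi>" "flact 0 \<xi> = 0" "flact a 0 = 0" "flact 1 \<xi> = \<xi>"
  "flact a (- \<xi>) = - flact a \<xi>"
  by (transfer, simp add: falg_simps algebra_simps)+

lemma fract_simps: "fract (\<xi> + \<eta>) a = fract \<xi> a + fract \<eta> a" "fract \<xi> (a + b) = fract \<xi> a + fract \<xi> b"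
  "fract (fract \<xi> a) b = fract \<xi> (a * b)" "fract \<xi> 0 = 0" "fract 0 a = 0" "fract \<xi> 1 = \<xi>"
  "fract (- \<xi>) a = - fract \<xi> a"
  by (transfer, simp add: falg_simps algebra_simps)+

lemma fract_flact: "fract (flact a \<xi>) b = flact a (fract \<xi> b)"
  by transfer (simp add: mult.assoc)

lemma fract_scal: "fract \<xi> (scal c) = flact (scal c) \<xi>"
  by transfer (simp add: falg_scal_commute)

text \<open>Leibniz rule for the product \<open>chi j * chi i\<close>, which is \<open>chi j\<close>
  or 0. Moving idempotents across \<open>e_form\<close> in this way yields both
  \<open>chi_e_form\<close> and \<open>arrow_same\<close>.\<close>

lemma e_form_mult_chi: 
  "e_form j * falg (chi i) = (if i = j then e_form j else 0) - falg (chi j) * e_form i"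
proof -
  have "dform (falg (chi j * chi i)) = e_form j * falg (chi i) + falg (chi j) * e_form i"
    by (simp add: e_form_def dform_falg dA_mult conn_simps) (simp add: falg_def)
  moreover have "dform (falg (chi j * chi i)) = (if i = j then e_form j else 0)"
    by (auto simp: chi_mult e_form_def dform_falg dA_zero conn_simps)
  ultimately show ?thesis by (simp add: eq_diff_eq)
qed

lemma chi_e_form:
  assumes "i \<noteq> j" shows "falg (chi i) * e_form j = Rep_form1 (arrow i j)"
proof -
  have "falg (chi i) * falg (chi j) = 0"
    using assms by (simp add: chi_mult falg_simps flip: falg_simps(2))
  moreover have "Rep_form1 (arrow i j) = falg (chi i) * e_form j - falg (chi i) * falg (chi j) * e_form j"
    by (simp only: arrow.rep_eq mult.assoc e_form_mult_chi if_P[OF HOL.refl] right_diff_distrib)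
  ultimately show ?thesis by simp
qed

lemma arrow_same: "arrow i i = 0"
proof -
  have "falg (chi i) * falg (chi i) = falg (chi i)"
    by (simp add: chi_mult flip: falg_simps(2))
  moreover have "Rep_form1 (arrow i i) = falg (chi i) * e_form i - falg (chi i) * falg (chi i) * e_form i"
    by (simp only: arrow.rep_eq mult.assoc e_form_mult_chi if_P[OF HOL.refl] right_diff_distrib)
  ultimately have "Rep_form1 (arrow i i) = 0" by simp
  then show ?thesis by (simp flip: Rep_form1_inject zero_form1.rep_eq)
qed

text \<open>Constants are closed, so the differential is linear over them. All three
  \<open>e_form k\<close> are kept, although they add up to \<open>d 1 = 0\<close>, in order to
  treat the points alike.\<close>

lemma dform_falg_eq_sum: "dform (falg b) = (\<Sum>k\<in>UNIV. falg (scal (b $ k)) * e_form k)"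
proof -
  have sc: "dform (falg (scal c * a)) = falg (scal c) * dform (falg a)" for c a
    by (simp add: dform_falg dA_mult dA_scal conn_simps) (simp add: falg_def)
  have add: "dform (falg (a + b)) = dform (falg a) + dform (falg b)" for a b
    by (simp add: dform_falg dA_add conn_simps)
  have zero: "dform (falg 0) = 0" by (simp add: dform_falg dA_zero conn_simps)
  have sum: "dform (falg (\<Sum>k\<in>K. f k)) = (\<Sum>k\<in>K. dform (falg (f k)))" for f :: "3 \<Rightarrow> alg" and K
    by (induct K rule: infinite_finite_induct) (simp_all add: zero add)
  have "dform (falg b) = dform (falg (\<Sum>k\<in>UNIV. scal (b $ k) * chi k))"
    by (simp flip: alg_eq_sum_chi)
  then show ?thesis by (simp only: sum sc e_form_def)
qed

text \<open>These are the Peirce corners for the idempotents \<open>chi i\<close>. The coefficient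
  is hidden by a quantifier so that closure under the operations suffices; the type is
  \<open>form\<close> because the induction behind it runs through classes of universal
  forms.\<close>

definition split_arrows :: "form \<Rightarrow> bool" where
  "split_arrows \<xi> \<longleftrightarrow>
     (\<forall>i j. \<exists>c. falg (chi i) * \<xi> * falg (chi j) = falg (scal c) * Rep_form1 (arrow i j))"

lemma split_arrows_zero: "split_arrows 0"
  unfolding split_arrows_def by (intro allI exI[of _ 0]) (simp add: falg_simps)

lemma split_arrows_add:
  assumes "split_arrows \<xi>" "split_arrows \<eta>" shows "split_arrows (\<xi> + \<eta>)"
  unfolding split_arrows_def
proof (intro allI)
  fix i j
  obtain c c' where "falg (chi i) * \<xi> * falg (chi j) = falg (scal c) * Rep_form1 (arrow i j)"
    "falg (chi i) * \<eta> * falg (chi j) = falg (scal c') * Rep_form1 (arrow i j)"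
    using assms unfolding split_arrows_def by blast
  then show "\<exists>c. falg (chi i) * (\<xi> + \<eta>) * falg (chi j) = falg (scal c) * Rep_form1 (arrow i j)"
    by (intro exI[of _ "c + c'"]) (simp add: falg_simps ring_distribs)
qed

text \<open>Next to \<open>chi i\<close> the function \<open>a\<close> is the number
  \<open>a $ i\<close>, so the action only rescales each corner.\<close>

lemma split_arrows_lact:
  assumes "split_arrows \<xi>" shows "split_arrows (falg a * \<xi>)"
  unfolding split_arrows_def
proof (intro allI)
  fix i j
  obtain c where c: "falg (chi i) * \<xi> * falg (chi j) = falg (scal c) * Rep_form1 (arrow i j)"
    using assms unfolding split_arrows_def by blast
  have "falg (chi i) * (falg a * \<xi>) * falg (chi j) = falg (a * chi i) * \<xi> * falg (chi j)"
    by (simp add: falg_simps(2) mult.commute[of a] mult.assoc)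
  also have "\<dots> = falg (scal (a $ i)) * (falg (chi i) * \<xi> * falg (chi j))"
    by (simp only: mult_chi[of a i] falg_simps(2) mult.assoc)
  also have "\<dots> = falg (scal (a $ i * c)) * Rep_form1 (arrow i j)"
    unfolding c by (simp only: falg_simps(2) scal_simps mult.assoc)
  finally show "\<exists>c. falg (chi i) * (falg a * \<xi>) * falg (chi j) = falg (scal c) * Rep_form1 (arrow i j)"
    by blast
qed

lemma split_arrows_ract:
  assumes "split_arrows \<xi>" shows "split_arrows (\<xi> * falg a)"
  unfolding split_arrows_def
proof (intro allI)
  fix i j
  obtain c where c: "falg (chi i) * \<xi> * falg (chi j) = falg (scal c) * Rep_form1 (arrow i j)"
    using assms unfolding split_arrows_def by blast
  have "falg (chi i) * (\<xi> * falg a) * falg (chi j) = (falg (chi i) * \<xi>) * falg (scal (a $ j)) * falg (chi j)"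
    using mult_chi[of a j] by (simp add: mult.assoc flip: falg_simps(2))
  also have "\<dots> = falg (scal (a $ j)) * (falg (chi i) * \<xi> * falg (chi j))"
    by (simp only: falg_scal_commute[symmetric] mult.assoc)
  also have "\<dots> = falg (scal (a $ j * c)) * Rep_form1 (arrow i j)"
    unfolding c by (simp only: falg_simps(2) scal_simps mult.assoc)
  finally show "\<exists>c. falg (chi i) * (\<xi> * falg a) * falg (chi j) = falg (scal c) * Rep_form1 (arrow i j)"
    by blast
qed

text \<open>For distinct \<open>i\<close> and \<open>j\<close> the coefficient is the value of
  \<open>chi k\<close> at \<open>j\<close> minus that at \<open>i\<close>: 1, 0 or -1, in the order
  of the cases. For \<open>i = j\<close> the arrow is zero.\<close>

lemma split_arrows_e_form: "split_arrows (e_form k)"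
  unfolding split_arrows_def
proof (intro allI)
  fix i j
  have z: "falg (chi i) * falg (chi k) = (if i = k then falg (chi i) else 0)"
    by (simp add: chi_mult falg_simps flip: falg_simps(2))
  have e: "falg (chi i) * e_form k * falg (chi j)
      = (if j = k then falg (chi i) * e_form k else 0) - falg (chi i) * falg (chi k) * e_form j"
    by (simp add: mult.assoc e_form_mult_chi right_diff_distrib)
  consider "k = j" | "k \<noteq> j" "i \<noteq> k" | "k \<noteq> j" "i = k" by blast
  then show "\<exists>c. falg (chi i) * e_form k * falg (chi j) = falg (scal c) * Rep_form1 (arrow i j)"
  proof cases
    case 1
    then show ?thesis by (intro exI[of _ 1]) (simp add: arrow.rep_eq falg_simps)
  next
    case 2
    then show ?thesis
      unfolding e by (intro exI[of _ 0]) (simp add: z falg_simps)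
  next
    case 3
    then show ?thesis
      unfolding e using z by (intro exI[of _ "- 1"]) (simp add: falg_simps chi_e_form)
  qed
qed

lemma split_arrows_dform: "split_arrows (dform (falg a))"
  unfolding dform_falg_eq_sum sum_3
  by (intro split_arrows_add split_arrows_lact split_arrows_e_form)

lemma split_arrows_uform: "split_arrows (conn (uform m))"
proof -
  have "split_arrows (conn (lift2 (\<lambda>a b. ualg a * dA b) t))" for t
  proof (induct t rule: alg2_induct)
    case (pure a b)
    then show ?case
      using split_arrows_lact[OF split_arrows_dform[of b, unfolded dform_falg], of a]
      by (simp only: form2_simps conn_simps(4) falg_def)
  next
    case (neg x)
    then show ?case using split_arrows_lact[of _ "- 1"] by (simp add: form2_simps conn_simps falg_simps)
  qed (simp_all add: form2_simps conn_simps split_arrows_zero split_arrows_add)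
  then show ?thesis by (simp add: uform_eq_lift2[of m])
qed

lemma split_arrows_Om:
  assumes "\<xi> \<in> Om 1" shows "split_arrows \<xi>"
proof -
  have "p = 1 \<longrightarrow> split_arrows (conn w)" if "udeg p w" for p w
    using that
  proof (induct rule: udeg.induct)
    case (zero p)
    then show ?case by (simp add: conn_simps split_arrows_zero)
  next
    case (form m)
    show ?case by (simp add: split_arrows_uform)
  next
    case (add p x y)
    then show ?case by (simp add: conn_simps split_arrows_add)
  next
    case (mult p x q y)
    show ?case
    proof
      assume "p + q = 1"
      \<comment> \<open>One factor has degree zero and is therefore an element of the algebra, by
        \<open>udeg_zeroD\<close>.\<close>
      then consider "p = 0" "q = 1" | "p = 1" "q = 0" by linarith
      then show "split_arrows (conn (x * y))"
      proof cases
        case 1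
        then have "conn x = falg (part0 x)" using mult udeg_zeroD unfolding falg_def by metis
        with 1 show ?thesis using mult by (simp add: conn_simps split_arrows_lact)
      next
        case 2
        then have "conn y = falg (part0 y)" using mult udeg_zeroD unfolding falg_def by metis
        with 2 show ?thesis using mult by (simp add: conn_simps split_arrows_ract)
      qed
    qed
  qed simp
  then show ?thesis using assms by (auto simp: Om_def)
qed

section \<open>Expansion of 1-forms in arrows\<close>

lemma form1_component: obtains c where "flact (chi i) (fract \<xi> (chi j)) = flact (scal c) (arrow i j)"
proof -
  have "split_arrows (Rep_form1 \<xi>)" by (rule split_arrows_Om[OF Rep_form1])
  then obtain c where "falg (chi i) * Rep_form1 \<xi> * falg (chi j) = falg (scal c) * Rep_form1 (arrow i j)"
    unfolding split_arrows_def by blast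
  then have "Rep_form1 (flact (chi i) (fract \<xi> (chi j))) = Rep_form1 (flact (scal c) (arrow i j))"
    by (simp add: flact.rep_eq fract.rep_eq mult.assoc)
  then show ?thesis using that by (simp add: Rep_form1_inject)
qed

lemma flact_sum: "flact (\<Sum>i\<in>I. f i) \<xi> = (\<Sum>i\<in>I. flact (f i) \<xi>)"
  by (induct I rule: infinite_finite_induct) (simp_all add: flact_simps)

lemma fract_sum: "fract \<xi> (\<Sum>i\<in>I. f i) = (\<Sum>i\<in>I. fract \<xi> (f i))"
  by (induct I rule: infinite_finite_induct) (simp_all add: fract_simps)

lemma form1_eq_sum: "\<xi> = (\<Sum>i\<in>UNIV. \<Sum>j\<in>UNIV. flact (chi i) (fract \<xi> (chi j)))"
proof -
  have "\<xi> = flact (\<Sum>i\<in>UNIV. chi i) (fract \<xi> (\<Sum>j\<in>UNIV. chi j))"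
    by (simp only: sum_chi flact_simps fract_simps)
  then show ?thesis by (simp only: flact_sum fract_sum sum_distrib_left) (simp add: flact_sum flact_simps sum_3)
qed

text \<open>The partition of unity \<open>sum_chi\<close>, inserted on both sides, cuts a 1-form
  into nine corners, each a multiple of an arrow.\<close>

lemma form1_arrow_induct [case_names arrow add]:
  assumes "\<And>c i j. P (flact (scal c) (arrow i j))" "\<And>\<xi> \<eta>. P \<xi> \<Longrightarrow> P \<eta> \<Longrightarrow> P (\<xi> + \<eta>)"
  shows "P \<xi>"
proof -
  have "P (flact (chi i) (fract \<xi> (chi j)))" for i j
    using form1_component[of i \<xi> j] assms(1) by metis
  then have "P (\<Sum>i\<in>UNIV. \<Sum>j\<in>UNIV. flact (chi i) (fract \<xi> (chi j)))"
    unfolding sum_3 by (intro assms(2))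
  then show ?thesis by (simp flip: form1_eq_sum)
qed

lemma flact_arrow: "flact a (arrow i j) = flact (scal (a $ i)) (arrow i j)"
proof -
  have "falg a * falg (chi i) = falg (scal (a $ i)) * falg (chi i)"
    by (metis mult_chi falg_simps(2))
  then show ?thesis by transfer (simp flip: mult.assoc)
qed

lemma fract_arrow: "fract (arrow i j) a = flact (scal (a $ j)) (arrow i j)"
proof -
  have "falg (chi j) * falg a = falg (chi j) * falg (scal (a $ j))"
    by (metis mult_chi falg_simps(2) mult.commute)
  then show ?thesis unfolding fract_scal[symmetric] by transfer (simp add: mult.assoc)
qed

text \<open>In \<open>[D, chi j]\<close> the term with \<open>chi j\<close> to the left of
  \<open>D\<close> is killed by \<open>chi i\<close>. What remains is one matrix unit in the block
  labelled by \<open>i\<close> and \<open>j\<close>.\<close>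

lemma form_oper_arrow:
  "form_oper (Rep_form1 (arrow i j)) = (if i = j then 0 else rep (chi i) ** Dirac ** rep (chi j))"
proof (cases "i = j")
  case False
  have "rep (chi i) ** rep (chi j) = 0" "rep (chi j) ** rep (chi j) = rep (chi j)"
    using False by (simp_all add: chi_mult rep_zero flip: rep_mult)
  then have "rep (chi i) ** (Dirac ** (rep (chi j) ** rep (chi j))) - rep (chi i) ** rep (chi j) ** Dirac ** rep (chi j)
      = rep (chi i) ** Dirac ** rep (chi j)"
    by (simp add: oper_distrib matrix_mul_assoc)
  then show ?thesis using False
    by (simp add: arrow.rep_eq form_oper_mult form_oper_falg form_oper_e_form comm_D_def oper_distrib matrix_mul_assoc)
qed (simp add: arrow_same zero_form1.rep_eq form_oper_zero)

section \<open>Explicit block matrices\<close>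

definition mat2 :: "complex \<Rightarrow> complex \<Rightarrow> complex \<Rightarrow> complex \<Rightarrow> complex^2^2" where
  "mat2 a b c d = vector [vector [a, b], vector [c, d]]"

lemma mat2_simps: "mat2 a b c d ** mat2 a' b' c' d' =
    mat2 (a * a' + b * c') (a * b' + b * d') (c * a' + d * c') (c * b' + d * d')"
  "mat2 a b c d + mat2 a' b' c' d' = mat2 (a + a') (b + b') (c + c') (d + d')"
  "mat2 a b c d = mat2 a' b' c' d' \<longleftrightarrow> a = a' \<and> b = b' \<and> c = c' \<and> d = d'"
  by (auto simp: mat2_def vec_eq_iff forall_2 matrix_matrix_mult_def sum_2)

lemma block_sum_eq_iff: "block_sum P Q R = block_sum P' Q' R' \<longleftrightarrow> P = P' \<and> Q = Q' \<and> R = R'"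
proof
  assume *: "block_sum P Q R = block_sum P' Q' R'"
  have "block_sum P Q R $ (i, k) $ (i, l) = block_sum P' Q' R' $ (i, k) $ (i, l)" for i k l
    by (simp add: *)
  from this[of 1] this[of 2] this[of 3] show "P = P' \<and> Q = Q' \<and> R = R'"
    by (simp add: block_sum_def vec_eq_iff)
qed simp

lemma rep_block: "rep f = block_sum (mat2 (f $ 1) 0 0 (f $ 2)) (mat2 (f $ 2) 0 0 (f $ 3)) (mat2 (f $ 1) 0 0 (f $ 3))"
  by (simp add: rep_def mat2_def)

lemma Dirac_block: "Dirac = block_sum (mat2 0 1 1 0) (mat2 0 1 1 0) (mat2 0 1 1 0)"
  by (simp add: Dirac_def mat2_def)

lemma zero_block: "0 = block_sum (mat2 0 0 0 0) (mat2 0 0 0 0) (mat2 0 0 0 0)"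
  by (auto simp: block_sum_def vec_eq_iff mat2_def forall_2)

lemmas block_simps = block_sum_mult block_sum_add block_sum_eq_iff mat2_simps

lemma chi_nth: "chi i $ j = (if i = j then 1 else 0)"
  by (simp add: chi_def)

text \<open>Non-vanishing in a quotient needs a model: the operators provide one, in which each of
  the six arrows is visibly nonzero.\<close>

lemma arrow_nonzero:
  assumes "i \<noteq> j" shows "arrow i j \<noteq> 0"
proof
  assume "arrow i j = 0"
  then have "rep (chi i) ** Dirac ** rep (chi j) = 0"
    using assms form_oper_arrow[of i j] by (simp add: zero_form1.rep_eq form_oper_zero)
  then show False
    using assms exhaust_3[of i] exhaust_3[of j]
    by (elim disjE) (simp_all add: rep_block Dirac_block zero_block block_simps chi_nth)
qed

section \<open>Metrics and their inverses\<close>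

lemma balanced_pure11: "balanced fract flact pure11"
  by (simp add: balanced_def pure11_simps)

lemma pure11_zero: "pure11 0 \<eta> = 0" "pure11 \<xi> 0 = 0"
  using pure11_simps(1)[of 0 0 \<eta>] pure11_simps(2)[of \<xi> 0 0] by simp_all

lemma lift11_pure11: "lift11 pure11 t = t"
  by (induct t rule: form11_induct)
     (simp_all add: lift11_zero lift11_pure lift11_add lift11_neg balanced_pure11)

lemma lact11_pure: "lact11 a (pure11 \<xi> \<eta>) = pure11 (flact a \<xi>) \<eta>"
  unfolding lact11_def
  by (rule lift11_pure) (simp add: balanced_def flact_simps pure11_simps flip: fract_flact)

lemma ract11_pure: "ract11 (pure11 \<xi> \<eta>) a = pure11 \<xi> (fract \<eta> a)"
  unfolding ract11_def
  by (rule lift11_pure) (simp add: balanced_def fract_simps pure11_simps fract_flact)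

context
  fixes g :: "form11 \<Rightarrow> alg"
  assumes metric: "is_metric g"
begin

lemma metric_add: "g (s + t) = g s + g t"
  using metric by (simp add: is_metric_def)

lemma metric_zero: "g 0 = 0"
  using metric_add[of 0 0] by simp

lemma metric_flact: "g (pure11 (flact a \<xi>) \<eta>) = a * g (pure11 \<xi> \<eta>)"
  using metric by (simp add: is_metric_def flip: lact11_pure)

lemma metric_fract: "g (pure11 \<xi> (fract \<eta> a)) = g (pure11 \<xi> \<eta>) * a"
  using metric by (simp add: is_metric_def flip: ract11_pure)

lemma metric_pure_add: "g (pure11 (\<xi> + \<xi>') \<eta>) = g (pure11 \<xi> \<eta>) + g (pure11 \<xi>' \<eta>)"
  "g (pure11 \<xi> (\<eta> + \<eta>')) = g (pure11 \<xi> \<eta>) + g (pure11 \<xi> \<eta>')"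
  by (simp_all add: pure11_simps metric_add)

lemma balanced_contract_left: "balanced fract flact (\<lambda>\<eta> \<zeta>. flact (g (pure11 \<xi> \<eta>)) \<zeta>)"
  by (simp add: balanced_def flact_simps metric_pure_add metric_fract)

lemma balanced_contract_right: "balanced fract flact (\<lambda>\<eta> \<zeta>. fract \<eta> (g (pure11 \<zeta> \<xi>)))"
  by (simp add: balanced_def fract_simps metric_pure_add metric_flact)

lemmas contract_left_simps =
  lift11_zero[OF balanced_contract_left, folded contract_left_def]
  lift11_pure[OF balanced_contract_left, folded contract_left_def]
  lift11_add[OF balanced_contract_left, folded contract_left_def]
  lift11_neg[OF balanced_contract_left, folded contract_left_def]

lemmas contract_right_simps =
  lift11_zero[OF balanced_contract_right, folded contract_right_def]
  lift11_pure[OF balanced_contract_right, folded contract_right_def]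
  lift11_add[OF balanced_contract_right, folded contract_right_def]
  lift11_neg[OF balanced_contract_right, folded contract_right_def]

lemma contract_left_linear:
  "contract_left g (\<xi> + \<xi>') t = contract_left g \<xi> t + contract_left g \<xi>' t"
  "contract_left g (flact a \<xi>) t = flact a (contract_left g \<xi> t)"
  by (induct t rule: form11_induct)
     (simp_all add: contract_left_simps metric_pure_add metric_flact flact_simps algebra_simps)

lemma contract_right_linear:
  "contract_right g t (\<xi> + \<xi>') = contract_right g t \<xi> + contract_right g t \<xi>'"
  "contract_right g t (fract \<xi> a) = fract (contract_right g t \<xi>) a"
  by (induct t rule: form11_induct)
     (simp_all add: contract_right_simps metric_pure_add metric_fract fract_simps algebra_simps)

text \<open>Both sides of the equation in the proof are \<open>(id \<otimes> g \<otimes> id)(s \<otimes> t)\<close>.\<close>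

lemma inverse_unique:
  assumes "\<And>\<xi>. contract_right g s \<xi> = \<xi>" "\<And>\<xi>. contract_left g \<xi> t = \<xi>"
  shows "s = t"
proof -
  let ?l = "\<lambda>t \<eta> \<zeta>. pure11 \<eta> (contract_left g \<zeta> t)"
  let ?r = "\<lambda>s \<eta> \<zeta>. pure11 (contract_right g s \<eta>) \<zeta>"
  have l: "balanced fract flact (?l t)" and r: "balanced fract flact (?r t)" for t
    by (simp_all add: balanced_def pure11_simps contract_left_linear contract_right_linear)
  note ls = lift11_zero[OF l] lift11_pure[OF l] lift11_add[OF l] lift11_neg[OF l]
  note rs = lift11_zero[OF r] lift11_pure[OF r] lift11_add[OF r] lift11_neg[OF r]
  have pn: "pure11 (- \<eta>) \<zeta> = - pure11 \<eta> \<zeta>" "pure11 \<eta> (- \<zeta>) = - pure11 \<eta> \<zeta>" for \<eta> \<zeta>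
    using pure11_simps(1)[of "- \<eta>" \<eta> \<zeta>] pure11_simps(2)[of \<eta> "- \<zeta>" \<zeta>]
    by (simp_all add: pure11_zero eq_neg_iff_add_eq_0)
  have "lift11 (?l t) s = lift11 (?r s) t" for s t
  \<comment> \<open>On the right, \<open>s\<close> sits inside the map being lifted, so additivity
    in \<open>s\<close> takes an inner induction on \<open>t\<close> in each case.\<close>
  proof (induct s rule: form11_induct)
    case zero
    have z: "balanced fract flact (\<lambda>_ _. 0 :: form11)" by (simp add: balanced_def)
    have "lift11 (\<lambda>_ _. 0 :: form11) t = 0"
      by (induct t rule: form11_induct)
         (simp_all add: lift11_zero[OF z] lift11_pure[OF z] lift11_add[OF z] lift11_neg[OF z])
    then show ?case by (simp add: ls contract_right_simps pure11_zero)
  next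
    case (pure \<xi> \<eta>)
    have "pure11 \<xi> (contract_left g \<eta> t) = lift11 (?r (pure11 \<xi> \<eta>)) t"
      by (induct t rule: form11_induct, simp_all only: rs)
         (simp_all add: contract_right_simps contract_left_simps pure11_zero pure11_simps pn)
    then show ?case by (simp only: ls)
  next
    case (add x y)
    have "lift11 (?r (x + y)) t = lift11 (?r x) t + lift11 (?r y) t"
      by (induct t rule: form11_induct, simp_all only: rs)
         (simp_all add: contract_right_simps pure11_simps)
    with add show ?case by (simp add: ls)
  next
    case (neg x)
    have "lift11 (?r (- x)) t = - lift11 (?r x) t"
      by (induct t rule: form11_induct, simp_all only: rs)
         (simp_all add: contract_right_simps pure11_simps pn)
    with neg show ?case by (simp add: ls)
  qed
  \<comment> \<open>Under the assumptions both lifted maps become \<open>pure11\<close>, so the two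
    sides are \<open>s\<close> and \<open>t\<close>.\<close>
  from this[of t s] show ?thesis by (simp add: assms lift11_pure11)
qed

section \<open>The coefficients of a metric and of its inverse\<close>

definition weight :: "3 \<Rightarrow> 3 \<Rightarrow> complex" where
  "weight i j = g (pure11 (arrow i j) (arrow j i)) $ i"

text \<open>The actions of \<open>chi i\<close> on the left and \<open>chi l\<close> on the right
  fix the two arrows and force the outer end points to agree; balancing \<open>chi j\<close> across
  the tensor sign does the same for the inner ones.\<close>

lemma metric_arrow:
  "g (pure11 (arrow i j) (arrow k l)) = (if j = k \<and> i = l then scal (weight i j) * chi i else 0)"
proof -
  let ?v = "g (pure11 (arrow i j) (arrow k l))"
  have i: "?v = chi i * ?v"
    using flact_arrow[of "chi i" i j] by (simp add: chi_nth flact_simps flip: metric_flact)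
  have l: "?v = ?v * chi l"
    using fract_arrow[of k l "chi l"] by (simp add: chi_nth flact_simps flip: metric_fract)
  have "?v = 0" if "j \<noteq> k"
  proof -
    have "arrow i j = fract (arrow i j) (chi j)"
      by (simp add: fract_arrow chi_nth flact_simps)
    then have "pure11 (arrow i j) (arrow k l) = pure11 (arrow i j) (flact (chi j) (arrow k l))"
      by (metis pure11_simps(3))
    then show ?thesis
      using that by (simp add: flact_arrow[of "chi j"] chi_nth flact_simps pure11_zero metric_zero)
  qed
  moreover have "?v = 0" if "i \<noteq> l"
  proof -
    have "?v = ?v * (chi i * chi l)" using i l by (metis mult.assoc mult.commute)
    then show ?thesis using that by (simp add: chi_mult)
  qed
  moreover have "?v = scal (?v $ i) * chi i"
    using i by (metis mult_chi mult.commute)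
  ultimately show ?thesis by (auto simp: weight_def)
qed

text \<open>Otherwise \<open>arrow i j\<close> would pair to zero with every arrow, hence with every
  1-form, against non-degeneracy.\<close>

lemma weight_nonzero:
  assumes "i \<noteq> j" shows "weight i j \<noteq> 0"
proof
  assume w: "weight i j = 0"
  have "g (pure11 (arrow i j) \<eta>) = 0" for \<eta>
  proof (induct \<eta> rule: form1_arrow_induct)
    case (arrow c k l)
    show ?case using w by (auto simp: metric_fract metric_arrow simp flip: fract_scal)
  qed (simp add: metric_pure_add)
  moreover have "g (pure11 0 \<eta>) = 0" for \<eta>
    by (simp add: pure11_zero metric_zero)
  moreover have "inj (\<lambda>\<xi> \<eta>. g (pure11 \<xi> \<eta>))"
    using metric by (simp add: is_metric_def bij_betw_def)
  ultimately have "arrow i j = 0" by (simp add: inj_def fun_eq_iff)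
  then show False using arrow_nonzero[OF assms] by simp
qed

text \<open>The terms with \<open>i = j\<close> vanish together with their arrows, so the division
  by \<open>weight i i\<close>, which is zero, does no harm.\<close>

definition inverse_metric :: form11 where
  "inverse_metric =
     (\<Sum>i\<in>UNIV. \<Sum>j\<in>UNIV. pure11 (flact (scal (1 / weight i j)) (arrow j i)) (arrow i j))"

lemma contract_left_inverse: "contract_left g \<xi> inverse_metric = \<xi>"
proof (induct \<xi> rule: form1_arrow_induct)
  case (arrow c k l)
  have sum: "contract_left g \<xi> (\<Sum>i\<in>I. f i) = (\<Sum>i\<in>I. contract_left g \<xi> (f i))"
    for \<xi> and I :: "3 set" and f
    by (induct I rule: infinite_finite_induct) (simp_all add: contract_left_simps)
  \<comment> \<open>Nested conditionals, rather than a conjunction, let the simplifier collapse the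
    two sums one after the other.\<close>
  have "flact (g (pure11 (arrow k l) (flact (scal (1 / weight i j)) (arrow j i)))) (arrow i j)
      = (if j = l then if i = k then arrow k l else 0 else 0)" for i j
  proof (cases "i = j")
    case False
    have "scal (weight i j) * chi i * scal (1 / weight i j) = chi i"
      using weight_nonzero[OF False] by (simp add: scal_def vec_eq_iff)
    then show ?thesis
      by (auto simp: metric_fract metric_arrow flact_simps flact_arrow[of "chi k"] chi_nth
          simp flip: fract_scal)
  qed (simp add: arrow_same flact_simps)
  then have "contract_left g (arrow k l) inverse_metric = arrow k l"
    unfolding inverse_metric_def by (simp add: sum contract_left_simps)
  then show ?case by (simp add: contract_left_linear)
qed (simp add: contract_left_linear)

lemma contract_right_inverse: "contract_right g inverse_metric \<xi> = \<xi>"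
proof (induct \<xi> rule: form1_arrow_induct)
  case (arrow c k l)
  have sum: "contract_right g (\<Sum>i\<in>I. f i) \<xi> = (\<Sum>i\<in>I. contract_right g (f i) \<xi>)"
    for \<xi> and I :: "3 set" and f
    by (induct I rule: infinite_finite_induct) (simp_all add: contract_right_simps)
  have "fract (flact (scal (1 / weight i j)) (arrow j i)) (g (pure11 (arrow i j) (arrow k l)))
      = (if j = k then if i = l then arrow k l else 0 else 0)" for i j
  proof (cases "i = j")
    case False
    have "scal (1 / weight i j) * (scal (weight i j) * chi i) = chi i"
      using weight_nonzero[OF False] by (simp add: scal_def vec_eq_iff)
    then show ?thesis
      by (auto simp: metric_arrow fract_simps fract_arrow[of _ _ "chi l"] chi_nth flact_simps
          simp flip: fract_scal)
  qed (simp add: arrow_same flact_simps fract_simps)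
  then have "contract_right g inverse_metric (arrow k l) = arrow k l"
    unfolding inverse_metric_def by (simp add: sum contract_right_simps)
  then show ?case by (simp add: contract_right_linear flip: fract_scal)
qed (simp add: contract_right_linear)

lemma metric_inverse_eq: "metric_inverse g = inverse_metric"
  unfolding metric_inverse_def
  by (rule the_equality)
     (use contract_left_inverse contract_right_inverse inverse_unique in blast)+

end

section \<open>Complex structures and fundamental forms\<close>

text \<open>Right linearity of one factor and left linearity of the other are what makes
  \<open>map11\<close> well defined on the tensor product over the algebra.\<close>

definition bimodule_map :: "(form1 \<Rightarrow> form1) \<Rightarrow> bool" where
  "bimodule_map F \<longleftrightarrow> (\<forall>\<xi> \<eta>. F (\<xi> + \<eta>) = F \<xi> + F \<eta>) \<and>
     (\<forall>a \<xi>. F (flact a \<xi>) = flact a (F \<xi>)) \<and> (\<forall>a \<xi>. F (fract \<xi> a) = fract (F \<xi>) a)"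

lemma bimodule_map_ident: "bimodule_map (\<lambda>\<xi>. \<xi>)"
  by (simp add: bimodule_map_def)

lemma bimodule_map_add: "bimodule_map F \<Longrightarrow> bimodule_map G \<Longrightarrow> bimodule_map (\<lambda>\<xi>. F \<xi> + G \<xi>)"
  by (simp add: bimodule_map_def flact_simps(1) fract_simps(1) add_ac)

lemma bimodule_map_scal:
  assumes "bimodule_map F" shows "bimodule_map (\<lambda>\<xi>. flact (scal c) (F \<xi>))"
proof -
  have "flact (scal c) (flact a \<xi>) = flact a (flact (scal c) \<xi>)" for a \<xi>
    by (simp add: flact_simps(3) mult.commute)
  then show ?thesis using assms by (simp add: bimodule_map_def flact_simps(1) fract_flact)
qed

context
  fixes F G :: "form1 \<Rightarrow> form1"
  assumes bimod: "bimodule_map F" "bimodule_map G"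
begin

lemma balanced_map11: "balanced fract flact (\<lambda>\<xi> \<eta>. pure11 (F \<xi>) (G \<eta>))"
  using bimod by (simp add: balanced_def bimodule_map_def pure11_simps)

lemmas map11_simps =
  lift11_zero[OF balanced_map11, folded map11_def]
  lift11_pure[OF balanced_map11, folded map11_def]
  lift11_add[OF balanced_map11, folded map11_def]

lemma map11_sum: "map11 F G (\<Sum>i\<in>I. f i) = (\<Sum>i\<in>I. map11 F G (f i))"
  by (induct I rule: infinite_finite_induct) (simp_all add: map11_simps)

end

lemma balanced_wedge: "balanced fract flact (\<lambda>\<xi> \<eta>. Rep_form1 \<xi> * Rep_form1 \<eta>)"
  by (simp add: balanced_def plus_form1.rep_eq flact.rep_eq fract.rep_eq algebra_simps)

lemmas wedge11_simps =
  lift11_zero[OF balanced_wedge, folded wedge11_def]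
  lift11_pure[OF balanced_wedge, folded wedge11_def]
  lift11_add[OF balanced_wedge, folded wedge11_def]

lemma wedge11_sum: "wedge11 (\<Sum>i\<in>I. f i) = (\<Sum>i\<in>I. wedge11 (f i))"
  by (induct I rule: infinite_finite_induct) (simp_all add: wedge11_simps)

lemma Rep_on1: "F (Rep_form1 \<xi>) \<in> Om 1 \<Longrightarrow> Rep_form1 (on1 F \<xi>) = F (Rep_form1 \<xi>)"
  by (simp add: on1_def Abs_form1_inverse)

text \<open>The involution fixes \<open>chi i\<close> and \<open>e_form j\<close> and reverses their
  product; moving \<open>chi i\<close> back to the left by \<open>e_form_mult_chi\<close> gives the
  sign and exchanges the end points.\<close>

lemma fstar_arrow:
  assumes "i \<noteq> j"
  shows "fstar (falg (scal c) * Rep_form1 (arrow i j)) = - (falg (scal (cnj c)) * Rep_form1 (arrow j i))"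
proof -
  have s: "fstar (falg (scal c) * \<xi>) = falg (scal (cnj c)) * fstar \<xi>"
    "fstar (falg a) = falg (alg_star a)" "fstar (dform \<xi>) = dform (fstar \<xi>)"
    "\<xi> \<in> Om p \<Longrightarrow> \<eta> \<in> Om q \<Longrightarrow> fstar (\<xi> * \<eta>) = (-1) ^ (p * q) * (fstar \<eta> * fstar \<xi>)"
    for \<xi> \<eta> c a p q
    using star_involution_fstar unfolding star_involution_def by (blast, blast, metis, blast)
  have chi: "alg_star (chi k) = chi k" for k
    by (simp add: alg_star_def chi_def vec_eq_iff)
  then have e: "fstar (e_form j) = e_form j"
    by (simp add: e_form_def s)
  have "fstar (Rep_form1 (arrow i j)) = fstar (falg (chi i) * e_form j)"
    using assms by (simp add: chi_e_form)
  also have "\<dots> = e_form j * falg (chi i)"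
    by (simp add: s(4)[OF falg_Om e_form_Om] s(2) chi e)
  also have "\<dots> = - Rep_form1 (arrow j i)"
    using assms by (simp add: e_form_mult_chi chi_e_form)
  finally show ?thesis by (simp add: s(1))
qed

lemma flact_scal: "flact (scal c) (flact (scal c') \<xi>) = flact (scal (c * c')) \<xi>"
  "flact (scal 1) \<xi> = \<xi>" "flact (scal 0) \<xi> = 0" "flact (scal (- c)) \<xi> = - flact (scal c) \<xi>"
  "flact (scal c) \<xi> + flact (scal c') \<xi> = flact (scal (c + c')) \<xi>"
  using flact_simps(2)[of "scal c" "- scal c" \<xi>]
  by (simp_all add: flact_simps eq_neg_iff_add_eq_0 add.commute)

lemma flact_scal_eq_zero: "flact (scal c) \<xi> = 0 \<longleftrightarrow> c = 0 \<or> \<xi> = 0"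
proof -
  have "\<xi> = flact (scal (inverse c * c)) \<xi>" if "c \<noteq> 0"
    using that by (simp add: flact_simps del: scal_simps(5))
  then show ?thesis by (metis flact_simps(3-5) scal_simps(1,5))
qed

section \<open>An almost complex structure on arrows\<close>

context
  fixes J :: "form \<Rightarrow> form"
  assumes acs: "almost_complex J"
begin

abbreviation J1 :: "form1 \<Rightarrow> form1" where "J1 \<equiv> on1 J"

lemma Rep_J1: "Rep_form1 (J1 \<xi>) = J (Rep_form1 \<xi>)"
  using acs Rep_form1[of \<xi>] by (intro Rep_on1) (simp add: almost_complex_def)

lemma J_falg: "J (falg a * \<xi>) = falg a * J \<xi>" "J (\<xi> * falg a) = J \<xi> * falg a"
  using acs unfolding almost_complex_def by simp_all

lemma bimodule_map_J1: "bimodule_map J1"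
proof -
  have "J (\<xi> + \<eta>) = J \<xi> + J \<eta>" for \<xi> \<eta> using acs unfolding almost_complex_def by blast
  then show ?thesis
    unfolding bimodule_map_def Rep_form1_inject[symmetric] plus_form1.rep_eq Rep_J1 flact.rep_eq fract.rep_eq
    by (simp add: J_falg)
qed

lemma J1_J1: "J1 (J1 \<xi>) = - \<xi>"
  using acs Rep_form1[of \<xi>]
  unfolding Rep_form1_inject[symmetric] Rep_J1 uminus_form1.rep_eq almost_complex_def by blast

text \<open>For \<open>i = j\<close> every number qualifies, since the arrow is zero; such a value
  only ever multiplies a zero form.\<close>

definition J_coeff :: "3 \<Rightarrow> 3 \<Rightarrow> complex" where
  "J_coeff i j = (SOME c. J1 (arrow i j) = flact (scal c) (arrow i j))"

text \<open>A bimodule map commutes with the idempotents, so the image stays in the corner of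
  \<open>arrow i j\<close>, which is a line.\<close>

lemma J1_arrow: "J1 (arrow i j) = flact (scal (J_coeff i j)) (arrow i j)"
proof -
  obtain c where c: "flact (chi i) (fract (J1 (arrow i j)) (chi j)) = flact (scal c) (arrow i j)"
    by (rule form1_component)
  have "J1 (arrow i j) = J1 (flact (chi i) (fract (arrow i j) (chi j)))"
    by (simp add: fract_arrow flact_arrow[of "chi i"] chi_nth flact_simps)
  also have "\<dots> = flact (scal c) (arrow i j)"
    using bimodule_map_J1 c by (simp add: bimodule_map_def)
  finally show ?thesis unfolding J_coeff_def by (rule someI)
qed

text \<open>The square of the coefficient is -1 by \<open>J1_J1\<close>, and compatibility with the
  involution makes the coefficients of opposite arrows complex conjugate.\<close>

lemma J_coeff:
  assumes "i \<noteq> j"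
  shows "J_coeff i j = \<i> \<and> J_coeff j i = - \<i> \<or> J_coeff i j = - \<i> \<and> J_coeff j i = \<i>"
proof -
  have "J1 (flact a \<xi>) = flact a (J1 \<xi>)" for a \<xi>
    using bimodule_map_J1 by (simp add: bimodule_map_def)
  then have "flact (scal (J_coeff i j * J_coeff i j)) (arrow i j) = - arrow i j"
    using J1_J1[of "arrow i j"] by (simp add: J1_arrow flact_simps)
  then have "flact (scal (J_coeff i j * J_coeff i j + 1)) (arrow i j) = 0"
    by (simp add: flact_simps)
  then have "J_coeff i j * J_coeff i j + 1 = 0"
    using arrow_nonzero[OF assms] unfolding flact_scal_eq_zero by blast
  then have sq: "J_coeff i j = \<i> \<or> J_coeff i j = - \<i>"
    by (metis add_eq_0_iff2 i_squared minus_minus square_eq_iff)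
  have "J (fstar (Rep_form1 (arrow i j))) = fstar (J (Rep_form1 (arrow i j)))"
    using acs Rep_form1 unfolding almost_complex_def by blast
  moreover have "fstar (Rep_form1 (arrow i j)) = - Rep_form1 (arrow j i)"
    using fstar_arrow[OF assms, of 1] by (simp add: falg_simps)
  moreover have "J (- \<xi>) = - J \<xi>" for \<xi>
    using J_falg(1)[of "- 1" \<xi>] by (simp add: falg_simps)
  ultimately have "- J (Rep_form1 (arrow j i)) = fstar (Rep_form1 (J1 (arrow i j)))"
    by (simp add: Rep_J1)
  then have "J1 (arrow j i) = flact (scal (cnj (J_coeff i j))) (arrow j i)"
    using assms
    by (simp add: J1_arrow flact.rep_eq fstar_arrow flip: Rep_J1 Rep_form1_inject)
  then have "flact (scal (J_coeff j i + - cnj (J_coeff i j))) (arrow j i) = 0"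
    unfolding flact_scal(5)[symmetric] flact_scal(4) by (simp add: J1_arrow)
  then have "J_coeff j i + - cnj (J_coeff i j) = 0"
    using arrow_nonzero[of j i] assms unfolding flact_scal_eq_zero by blast
  with sq show ?thesis by auto
qed

text \<open>The spectral projections of \<open>J1\<close> for the eigenvalues \<open>\<i>\<close>
  and, in \<open>proj01\<close>, \<open>- \<i>\<close>. They serve as explicit versions of the
  projections that \<open>proj_pq\<close> defines by description.\<close>

definition proj10 :: "form1 \<Rightarrow> form1" where
  "proj10 \<xi> = flact (scal (1/2)) (\<xi> + flact (scal (- \<i>)) (J1 \<xi>))"

definition proj01 :: "form1 \<Rightarrow> form1" where
  "proj01 \<xi> = flact (scal (1/2)) (\<xi> + flact (scal \<i>) (J1 \<xi>))"

lemma Om_pq_1: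
  "\<alpha> \<in> Om_pq J (Suc 0) 0 \<longleftrightarrow> (\<exists>\<eta>. \<alpha> = Rep_form1 \<eta> \<and> J1 \<eta> = flact (scal \<i>) \<eta>)"
  "\<alpha> \<in> Om_pq J 0 (Suc 0) \<longleftrightarrow> (\<exists>\<eta>. \<alpha> = Rep_form1 \<eta> \<and> J1 \<eta> = flact (scal (- \<i>)) \<eta>)"
  using Rep_form1 Rep_form1_cases[of \<alpha>]
  by (auto simp: Om_pq_def Rep_J1 flact.rep_eq simp flip: Rep_form1_inject)

text \<open>Kept general in \<open>c\<close> so as to apply both to forms of pure type and to
  arrows, where \<open>c\<close> is \<open>J_coeff\<close>.\<close>

lemma proj_eigen:
  assumes "J1 \<eta> = flact (scal c) \<eta>"
  shows "proj10 \<eta> = flact (scal ((1 - \<i> * c) / 2)) \<eta>" "proj01 \<eta> = flact (scal ((1 + \<i> * c) / 2)) \<eta>"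
proof -
  have "flact (scal (1/2)) (\<eta> + flact (scal x) (J1 \<eta>)) = flact (scal ((1 + x * c) / 2)) \<eta>" for x
  proof -
    have "flact (scal (1/2)) (\<eta> + flact (scal x) (J1 \<eta>))
        = flact (scal (1/2)) \<eta> + flact (scal (1/2 * (x * c))) \<eta>"
      by (simp only: assms flact_simps(1) flact_scal)
    also have "\<dots> = flact (scal (1/2 + 1/2 * (x * c))) \<eta>" by (simp only: flact_scal)
    also have "1/2 + 1/2 * (x * c) = (1 + x * c) / 2" by (simp add: field_simps)
    finally show ?thesis .
  qed
  from this[of "- \<i>"] this[of \<i>] show "proj10 \<eta> = flact (scal ((1 - \<i> * c) / 2)) \<eta>"
    "proj01 \<eta> = flact (scal ((1 + \<i> * c) / 2)) \<eta>"
    by (simp_all add: proj10_def proj01_def del: scal_simps)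
qed

lemma bimodule_map_proj: "bimodule_map proj10" "bimodule_map proj01"
  unfolding proj10_def[abs_def] proj01_def[abs_def]
  by (intro bimodule_map_add bimodule_map_scal bimodule_map_J1 bimodule_map_ident)+

lemma eigen_proj: "J1 (proj10 \<xi>) = flact (scal \<i>) (proj10 \<xi>)"
  "J1 (proj01 \<xi>) = flact (scal (- \<i>)) (proj01 \<xi>)"
proof -
  have J: "J1 (\<xi> + \<eta>) = J1 \<xi> + J1 \<eta>" "J1 (flact a \<xi>) = flact a (J1 \<xi>)" for \<xi> \<eta> a
    using bimodule_map_J1 by (simp_all add: bimodule_map_def)
  have JJ: "J1 (J1 \<xi>) = flact (scal (- 1)) \<xi>" for \<xi>
    unfolding J1_J1 flact_scal(4) flact_scal(2) ..
  show "J1 (proj10 \<xi>) = flact (scal \<i>) (proj10 \<xi>)"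
    "J1 (proj01 \<xi>) = flact (scal (- \<i>)) (proj01 \<xi>)"
    unfolding proj10_def proj01_def by (simp_all only: J JJ flact_simps(1) flact_scal(1)) (simp_all add: add.commute)
qed

lemma proj10_proj01: "proj10 \<xi> + proj01 \<xi> = \<xi>"
proof -
  have "proj10 \<xi> + proj01 \<xi> = (flact (scal (1/2)) \<xi> + flact (scal (1/2)) \<xi>)
      + (flact (scal (1/2 * - \<i>)) (J1 \<xi>) + flact (scal (1/2 * \<i>)) (J1 \<xi>))"
    unfolding proj10_def proj01_def by (simp only: flact_simps(1) flact_scal(1) add_ac)
  also have "\<dots> = flact (scal (1/2 + 1/2)) \<xi> + flact (scal (1/2 * - \<i> + 1/2 * \<i>)) (J1 \<xi>)"
    by (simp only: flact_scal(5))
  also have "1/2 + 1/2 = (1::complex)" by simp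
  also have "1/2 * - \<i> + 1/2 * \<i> = 0" by simp
  finally show ?thesis by (simp only: flact_scal(2,3) add_0_right)
qed

text \<open>Solves the condition that defines \<open>proj_pq\<close> in degree one, giving existence
  and uniqueness at once: applying the projections to a sum of eigenvectors recovers the
  summands.\<close>

lemma type_decomposition:
  "(\<forall>r\<le>Suc 0. f r \<in> Om_pq J r (Suc 0 - r)) \<and> Rep_form1 \<xi> = (\<Sum>r\<le>Suc 0. f r) \<longleftrightarrow>
     f 0 = Rep_form1 (proj01 \<xi>) \<and> f (Suc 0) = Rep_form1 (proj10 \<xi>)"  (is "?l \<longleftrightarrow> ?r")
proof
  assume ?l
  then have "f 0 \<in> Om_pq J 0 (Suc 0)" "f (Suc 0) \<in> Om_pq J (Suc 0) 0" by force+
  then obtain \<eta> \<eta>' where \<eta>: "f 0 = Rep_form1 \<eta>" "J1 \<eta> = flact (scal (- \<i>)) \<eta>"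
    "f (Suc 0) = Rep_form1 \<eta>'" "J1 \<eta>' = flact (scal \<i>) \<eta>'"
    unfolding Om_pq_1 by blast
  with \<open>?l\<close> have \<xi>: "\<xi> = \<eta> + \<eta>'"
    by (simp add: plus_form1.rep_eq flip: Rep_form1_inject)
  show ?r
    using bimodule_map_proj proj_eigen[OF \<eta>(2)] proj_eigen[OF \<eta>(4)]
    by (simp add: \<xi> \<eta> bimodule_map_def flact_scal del: scal_simps)
next
  assume r: ?r
  have "Rep_form1 \<xi> = Rep_form1 (proj01 \<xi>) + Rep_form1 (proj10 \<xi>)"
    using proj10_proj01[of \<xi>] by (metis add.commute plus_form1.rep_eq)
  moreover have "Rep_form1 (proj01 \<xi>) \<in> Om_pq J 0 (Suc 0)" "Rep_form1 (proj10 \<xi>) \<in> Om_pq J (Suc 0) 0"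
    unfolding Om_pq_1 using eigen_proj by blast+
  ultimately show ?l using r by (auto simp: le_Suc_eq)
qed

lemma on1_proj_pq: "on1 (proj_pq J 1 0) = proj10" "on1 (proj_pq J 0 1) = proj01"
proof -
  \<comment> \<open>A witness for the decomposition; its values beyond 1 are arbitrary.\<close>
  define f where "f \<xi> r = (if r = 0 then Rep_form1 (proj01 \<xi>) else Rep_form1 (proj10 \<xi>))" for \<xi> and r :: nat
  have f: "f \<xi> 0 = Rep_form1 (proj01 \<xi>) \<and> f \<xi> (Suc 0) = Rep_form1 (proj10 \<xi>)" for \<xi>
    by (simp add: f_def)
  have "proj_pq J 1 0 (Rep_form1 \<xi>) = Rep_form1 (proj10 \<xi>)"
    "proj_pq J 0 1 (Rep_form1 \<xi>) = Rep_form1 (proj01 \<xi>)" for \<xi>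
    unfolding proj_pq_def One_nat_def add_0_right add_0_left conj_assoc[symmetric] type_decomposition
    by (rule the_equality, use f in metis, metis)+
  then show "on1 (proj_pq J 1 0) = proj10" "on1 (proj_pq J 0 1) = proj01"
    by (simp_all add: on1_def Rep_form1_inverse fun_eq_iff)
qed

text \<open>The first factor comes from \<open>J1\<close>, the two halves are the eigenvalues of
  \<open>proj10\<close> on \<open>arrow j i\<close> and of \<open>proj01\<close> on
  \<open>arrow i j\<close>. For distinct points \<open>J_coeff\<close> makes both 1 or both
  0.\<close>

lemma fundamental_form_eq:
  assumes "is_metric g"
  shows "fundamental_form J g = (\<Sum>i\<in>UNIV. \<Sum>j\<in>UNIV.
     falg (scal (J_coeff j i * ((1 - \<i> * J_coeff j i) / 2) * ((1 + \<i> * J_coeff i j) / 2) / weight g i j))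
       * (Rep_form1 (arrow j i) * Rep_form1 (arrow i j)))"
proof -
  have id: "bimodule_map id" by (simp add: bimodule_map_def)
  have l: "J1 (flact a \<xi>) = flact a (J1 \<xi>)" "proj10 (flact a \<xi>) = flact a (proj10 \<xi>)" for a \<xi>
    using bimodule_map_J1 bimodule_map_proj by (simp_all add: bimodule_map_def)
  have "Rep_form1 (J1 (proj10 (flact (scal (1 / weight g i j)) (arrow j i)))) * Rep_form1 (proj01 (arrow i j))
      = falg (scal (J_coeff j i * ((1 - \<i> * J_coeff j i) / 2) * ((1 + \<i> * J_coeff i j) / 2) / weight g i j))
       * (Rep_form1 (arrow j i) * Rep_form1 (arrow i j))" for i j
  proof -
    have "Rep_form1 (J1 (proj10 (flact (scal (1 / weight g i j)) (arrow j i)))) * Rep_form1 (proj01 (arrow i j))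
      = falg (scal (1 / weight g i j * (((1 - \<i> * J_coeff j i) / 2) * J_coeff j i)))
        * (Rep_form1 (arrow j i) * falg (scal ((1 + \<i> * J_coeff i j) / 2))) * Rep_form1 (arrow i j)"
      by (simp only: l proj_eigen[OF J1_arrow] J1_arrow flact_scal flact.rep_eq mult.assoc)
    also have "\<dots> = falg (scal (1 / weight g i j * (((1 - \<i> * J_coeff j i) / 2) * J_coeff j i) * ((1 + \<i> * J_coeff i j) / 2)))
        * (Rep_form1 (arrow j i) * Rep_form1 (arrow i j))"
      by (simp only: falg_scal_commute[of _ "Rep_form1 (arrow j i)", symmetric] falg_simps(2)
          scal_simps(5) mult.assoc)
    finally show ?thesis by (simp add: mult_ac del: scal_simps)
  qed
  then show ?thesis
    unfolding fundamental_form_def on1_proj_pq metric_inverse_eq[OF assms] inverse_metric_def[OF assms]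
    by (simp add: map11_sum[OF bimodule_map_proj] map11_simps[OF bimodule_map_proj]
        map11_sum[OF bimodule_map_J1 id] map11_simps[OF bimodule_map_J1 id] wedge11_sum wedge11_simps)
qed

end

text \<open>The product of \<open>arrow j i\<close> and \<open>arrow i j\<close> starts and ends at
  \<open>j\<close>, so for distinct points it acts as the diagonal matrix unit at \<open>j\<close>
  in their common block, where \<open>w i j\<close> then appears.\<close>

lemma form_oper_arrow_sum:
  "form_oper (\<Sum>i\<in>UNIV. \<Sum>j\<in>UNIV. falg (scal (w i j)) * (Rep_form1 (arrow j i) * Rep_form1 (arrow i j)))
    = block_sum (mat2 (w 2 1) 0 0 (w 1 2)) (mat2 (w 3 2) 0 0 (w 2 3)) (mat2 (w 3 1) 0 0 (w 1 3))"
proof -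
  have "scal c $ k = c" for c k by (simp add: scal_def)
  then show ?thesis
    unfolding form_oper_sum form_oper_mult form_oper_falg form_oper_arrow unfolding sum_3
    by (simp add: rep_block Dirac_block zero_block block_simps chi_nth)
qed

text \<open>In even degree, closedness makes the operator commute with \<open>D\<close>. In the
  block 12, \<open>D\<close> swaps the coordinates, and a diagonal matrix commutes with the swap
  only if its entries agree.\<close>

lemma dform_arrow_sum:
  assumes "dform (\<Sum>i\<in>UNIV. \<Sum>j\<in>UNIV.
     falg (scal (w i j)) * (Rep_form1 (arrow j i) * Rep_form1 (arrow i j))) = 0" (is "dform ?\<omega> = 0")
  shows "w 1 2 = w 2 1"
proof -
  have "falg (scal (w i j)) * (Rep_form1 (arrow j i) * Rep_form1 (arrow i j)) \<in> Om 2" for i j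
    using Om_mult[OF falg_Om Om_mult[OF Rep_form1 Rep_form1]] by (simp add: numeral_2_eq_2)
  then have "?\<omega> \<in> Om 2" unfolding sum_3 by (intro Om_add)
  from form_oper_dform[OF this] have "Dirac ** form_oper ?\<omega> = form_oper ?\<omega> ** Dirac"
    by (simp add: assms form_oper_zero)
  then show ?thesis
    unfolding form_oper_arrow_sum Dirac_block block_simps mult_zero_left mult_zero_right mult_1_left
      mult_1_right add_0_left add_0_right
    by blast
qed

theorem theorem31:
  fixes J :: "form \<Rightarrow> form" and M :: "alg^2^2"
  assumes "complex_structure J"
    and "M \<in> J_matrices"
    and "J (e_form 1) = e_form 1 * falg (M $ 1 $ 1) + e_form 2 * falg (M $ 2 $ 1)"
    and "J (e_form 2) = e_form 1 * falg (M $ 1 $ 2) + e_form 2 * falg (M $ 2 $ 2)"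
  shows "\<nexists>g. is_metric g \<and> compatible g J \<and> is_kaehler g J"
proof
  assume "\<exists>g. is_metric g \<and> compatible g J \<and> is_kaehler g J"
  then obtain g where g: "is_metric g" "is_kaehler g J" by blast
  have acs: "almost_complex J" using assms(1) by (simp add: complex_structure_def)
  from g(2) have "dform (fundamental_form J g) = 0" by (simp add: is_kaehler_def)
  \<comment> \<open>Of the two coefficients for the points 1 and 2, one vanishes and the other is
    \<open>\<i>\<close> divided by a nonzero weight, so they cannot be equal.\<close>
  from dform_arrow_sum[OF this[unfolded fundamental_form_eq[OF acs g(1)]]] show False
    using J_coeff[OF acs, of 1 2] weight_nonzero[OF g(1), of 1 2] weight_nonzero[OF g(1), of 2 1]
    by auto
qed

end
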